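(* Let $1<p,q<\infty$. The space $X=\bigoplus_{\ell_p}\ell_q^n$ admits a separating polynomial if and only if $p$ and $q$ are both even integers and $p=kq$ for some $k\in\mathbb{N}$.
   Context: $\bigoplus_{\ell_p}\ell_q^n$ is the space of sequences $x=(x_n)_{n\ge1}$ with $x_n\in\ell_q^n$ and $\|x\|=(\sum_n\|x_n\|_q^p)^{1/p}<\infty$. A separating polynomial is a continuous polynomial $P$ with $P(0)=0$ and $P(x)\ge1$ for all $\|x\|=1$. *)

theory Defs
  imports Complex_Main
begin

text \<open>Elements of the direct sum: x n is the n-th block (n \<ge> 1), a vector of
  \<ell>_q^n with coordinates x n i, i < n. Unused coordinates are zero.\<close>

type_synonym blockseq = "nat \<Rightarrow> nat \<Rightarrow> real"

definition block_qnorm :: "real \<Rightarrow> blockseq \<Rightarrow> nat \<Rightarrow> real" where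
  "block_qnorm q x n = (\<Sum>i<n. \<bar>x n i\<bar> powr q) powr (1 / q)"

definition lp_lq_space :: "real \<Rightarrow> real \<Rightarrow> blockseq set" where
  "lp_lq_space p q = {x. (\<forall>i. x 0 i = 0) \<and> (\<forall>n i. n \<le> i \<longrightarrow> x n i = 0)
      \<and> summable (\<lambda>n. block_qnorm q x n powr p)}"

definition lp_lq_norm :: "real \<Rightarrow> real \<Rightarrow> blockseq \<Rightarrow> real" where
  "lp_lq_norm p q x = (\<Sum>n. block_qnorm q x n powr p) powr (1 / p)"

definition lincomb :: "real \<Rightarrow> blockseq \<Rightarrow> real \<Rightarrow> blockseq \<Rightarrow> blockseq" where
  "lincomb a u b v = (\<lambda>n i. a * u n i + b * v n i)"

definition multilinear_on :: "blockseq set \<Rightarrow> nat \<Rightarrow> (blockseq list \<Rightarrow> real) \<Rightarrow> bool" where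
  "multilinear_on S k A \<longleftrightarrow>
     (\<forall>xs. length xs = k \<and> set xs \<subseteq> S \<longrightarrow>
        (\<forall>j<k. \<forall>u\<in>S. \<forall>v\<in>S. \<forall>a b.
           A (xs[j := lincomb a u b v]) = a * A (xs[j := u]) + b * A (xs[j := v])))"

definition polynomial_on :: "blockseq set \<Rightarrow> (blockseq \<Rightarrow> real) \<Rightarrow> bool" where
  "polynomial_on S P \<longleftrightarrow>
     (\<exists>N A. (\<forall>k\<le>N. multilinear_on S k (A k)) \<and>
            (\<forall>x\<in>S. P x = (\<Sum>k\<le>N. A k (replicate k x))))"

definition separating_polynomial :: "real \<Rightarrow> real \<Rightarrow> (blockseq \<Rightarrow> real) \<Rightarrow> bool" where
  "separating_polynomial p q P \<longleftrightarrow>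
     polynomial_on (lp_lq_space p q) P \<and>
     (\<forall>x\<in>lp_lq_space p q. \<forall>e>0. \<exists>d>0. \<forall>y\<in>lp_lq_space p q.
         lp_lq_norm p q (lincomb 1 y (-1) x) < d \<longrightarrow> \<bar>P y - P x\<bar> < e) \<and>
     P (\<lambda>n i. 0) = 0 \<and>
     (\<forall>x\<in>lp_lq_space p q. lp_lq_norm p q x = 1 \<longrightarrow> P x \<ge> 1)"

end

theory Submission
  imports Defs "HOL-Analysis.Analysis"
begin

text \<open>
  If \<open>P\<close> is separating and \<open>r\<close> is \<open>p\<close> (blocks of the whole space) or \<open>q\<close> (coordinates of a
  large block), take a near-minimiser \<open>x\<close> of \<open>P - norm\<^sup>r / 2\<close> on the unit ball; it lies inside
  the ball, since the function is at least \<open>1/2\<close> on the sphere and vanishes at \<open>0\<close>. In a block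
  direction \<open>h\<close> where \<open>x\<close> is small, the second difference of \<open>P\<close> at \<open>x\<close> with step \<open>t\<close> is at
  least about \<open>t\<^sup>r\<close>. The Taylor coefficients of \<open>P\<close> at \<open>x\<close> of order \<open>k < r\<close> are negligible for
  most blocks: averaging over random subsets of \<open>m\<close> blocks bounds their sum by \<open>O(m\<^bsup>k/r\<^esup>)\<close>. So
  even orders at least \<open>r\<close> must produce \<open>t\<^sup>r\<close>, and \<open>r\<close> is an even integer.

  For \<open>r = p\<close> the coefficient of order \<open>p\<close> is then comparable to \<open>norm\<^sup>p\<close> on arbitrarily large
  blocks. Averaged over random subsets \<open>B\<close> of \<open>L\<close> coordinates with density \<open>\<theta>\<close> it becomes a
  polynomial in \<open>\<theta>\<close> of degree at most \<open>p\<close>, comparable to the mean of \<open>(card B)\<^bsup>p/q\<^esup>\<close>, which after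
  normalisation tends to \<open>\<theta>\<^bsup>p/q\<^esup>\<close> by Bernstein's theorem. Hence \<open>p/q\<close> is an integer.
  Conversely, \<open>norm\<^sup>p\<close> is itself a polynomial.
\<close>

section \<open>The mixed-norm space\<close>

lemma powr_convex_nonneg:
  fixes r x y u v :: real
  assumes "r \<ge> 1" "0 \<le> x" "0 \<le> y" "0 \<le> u" "0 \<le> v" "u + v = 1"
  shows "(u * x + v * y) powr r \<le> u * x powr r + v * y powr r"
proof -
  \<comment> \<open>When one of the two points is 0, convexity reduces to this inequality for the
    weight of the other point.\<close>
  have le_self: "w powr r \<le> w" if "0 \<le> w" "w \<le> 1" for w :: real
    using that assms(1) powr_mono'[of 1 r w] by (cases "w = 0") auto
  consider "x = 0" | "y = 0" | "x > 0" "y > 0" using assms by linarith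
  then show ?thesis
  proof cases
    case 1
    then show ?thesis
      using assms le_self[of v] by (auto simp: powr_mult intro!: mult_right_mono)
  next
    case 2
    then show ?thesis
      using assms le_self[of u] by (auto simp: powr_mult intro!: mult_right_mono)
  next
    case 3
    then show ?thesis
      using convex_onD[OF powr_convex[OF assms(1)], of v x y] assms
      by (simp add: eq_diff_eq[of u 1 v, THEN iffD2])
  qed
qed

text \<open>\<open>(a i + b i) / (A + B)\<close> is the convex combination of \<open>a i / A\<close>
  and \<open>b i / B\<close> with weights \<open>A / (A + B)\<close> and \<open>B / (A + B)\<close>,
  so convexity of the power can be summed over \<open>i\<close>. As \<open>A\<close> and
  \<open>B\<close> are only upper bounds, one pair of them serves all partial sums of a
  series.\<close>

lemma minkowski_sum_le:
  fixes a b :: "'i \<Rightarrow> real"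
  assumes r: "r \<ge> 1" and fin: "finite I"
    and a: "\<And>i. i \<in> I \<Longrightarrow> 0 \<le> a i" and b: "\<And>i. i \<in> I \<Longrightarrow> 0 \<le> b i"
    and A: "0 \<le> A" "(\<Sum>i\<in>I. a i powr r) \<le> A powr r"
    and B: "0 \<le> B" "(\<Sum>i\<in>I. b i powr r) \<le> B powr r"
  shows "(\<Sum>i\<in>I. (a i + b i) powr r) \<le> (A + B) powr r"
proof -
  have zero: "f i = 0" if "(\<Sum>i\<in>I. f i powr r) \<le> 0 powr r" "i \<in> I" for f :: "'i \<Rightarrow> real" and i
  proof -
    have "(\<Sum>i\<in>I. f i powr r) = 0"
      using that(1) r by (intro antisym sum_nonneg) auto
    then show ?thesis using that(2) fin by (simp add: sum_nonneg_eq_0_iff)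
  qed
  consider "A = 0" | "B = 0" | "A > 0" "B > 0" using A B by linarith
  then show ?thesis
  proof cases
    case 1
    then have "a i = 0" if "i \<in> I" for i using zero[of a i] A that by simp
    then show ?thesis using 1 B by simp
  next
    case 2
    then have "b i = 0" if "i \<in> I" for i using zero[of b i] B that by simp
    then show ?thesis using 2 A by simp
  next
    case 3
    define s where "s = A + B"
    have s: "s > 0" using 3 by (simp add: s_def)
    have AB: "A / s + B / s = 1" using s by (simp add: s_def flip: add_divide_distrib)
    have "(a i + b i) powr r \<le> s powr r * (A / s * (a i powr r / A powr r) + B / s * (b i powr r / B powr r))"
      if i: "i \<in> I" for i
    proof -
      have "(A / s * (a i / A) + B / s * (b i / B)) powr r
            \<le> A / s * (a i / A) powr r + B / s * (b i / B) powr r"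
        using 3 s a[OF i] b[OF i] r
        by (intro powr_convex_nonneg AB) auto
      moreover have "A / s * (a i / A) + B / s * (b i / B) = (a i + b i) / s"
        using 3 s by (simp add: add_divide_distrib)
      ultimately have "(a i + b i) powr r / s powr r
            \<le> A / s * (a i powr r / A powr r) + B / s * (b i powr r / B powr r)"
        using 3 s a[OF i] b[OF i] by (simp add: powr_divide)
      then show ?thesis using s by (simp add: field_simps)
    qed
    then have "(\<Sum>i\<in>I. (a i + b i) powr r)
        \<le> (\<Sum>i\<in>I. s powr r * (A / s * (a i powr r / A powr r) + B / s * (b i powr r / B powr r)))"
      by (rule sum_mono)
    also have "\<dots> = s powr r * (A / s * ((\<Sum>i\<in>I. a i powr r) / A powr r)
        + B / s * ((\<Sum>i\<in>I. b i powr r) / B powr r))"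
      by (simp only: sum.distrib sum_distrib_left sum_divide_distrib distrib_left)
    also have "\<dots> \<le> s powr r * (A / s * 1 + B / s * 1)"
      using 3 s A B by (intro mult_left_mono add_mono) auto
    also have "\<dots> = s powr r" using AB by simp
    finally show ?thesis by (simp add: s_def)
  qed
qed

text \<open>The single bound \<open>(A + B) powr r\<close> on all partial sums gives convergence and
  the inequality at once.\<close>

lemma minkowski_suminf_le:
  fixes a b :: "nat \<Rightarrow> real"
  assumes r: "r \<ge> 1" and a: "\<And>i. 0 \<le> a i" and b: "\<And>i. 0 \<le> b i"
    and sa: "summable (\<lambda>i. a i powr r)" and sb: "summable (\<lambda>i. b i powr r)"
  shows "summable (\<lambda>i. (a i + b i) powr r)"
    and "(\<Sum>i. (a i + b i) powr r) powr (1/r)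
       \<le> (\<Sum>i. a i powr r) powr (1/r) + (\<Sum>i. b i powr r) powr (1/r)"
proof -
  define A where "A = (\<Sum>i. a i powr r) powr (1/r)"
  define B where "B = (\<Sum>i. b i powr r) powr (1/r)"
  have Ar: "A powr r = (\<Sum>i. a i powr r)" and Br: "B powr r = (\<Sum>i. b i powr r)"
    using r suminf_nonneg[OF sa] suminf_nonneg[OF sb] by (auto simp: A_def B_def powr_powr)
  have partial: "(\<Sum>i<n. (a i + b i) powr r) \<le> (A + B) powr r" for n
    using r a b sum_le_suminf[OF sa, of "{..<n}"] sum_le_suminf[OF sb, of "{..<n}"]
    by (intro minkowski_sum_le) (auto simp: Ar Br, auto simp: A_def B_def)
  show *: "summable (\<lambda>i. (a i + b i) powr r)"
    by (rule summableI_nonneg_bounded[where x = "(A + B) powr r"]) (use partial in auto)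
  have "(\<Sum>i. (a i + b i) powr r) \<le> (A + B) powr r"
    using * partial by (rule suminf_le_const)
  then have "(\<Sum>i. (a i + b i) powr r) powr (1/r) \<le> ((A + B) powr r) powr (1/r)"
    using r * by (intro powr_mono2 suminf_nonneg) auto
  also have "\<dots> = A + B" using r by (simp add: powr_powr A_def B_def)
  finally show "(\<Sum>i. (a i + b i) powr r) powr (1/r)
       \<le> (\<Sum>i. a i powr r) powr (1/r) + (\<Sum>i. b i powr r) powr (1/r)"
    by (simp add: A_def B_def)
qed

section \<open>Norm and vector space structure of the direct sum\<close>

lemma block_qnorm_nonneg [simp]: "0 \<le> block_qnorm q x n"
  by (simp add: block_qnorm_def)

lemma lp_lq_norm_nonneg [simp]: "0 \<le> lp_lq_norm p q x"
  by (simp add: lp_lq_norm_def)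

lemma block_qnorm_scale:
  assumes "q > 1"
  shows "block_qnorm q (\<lambda>n i. c * x n i) n = \<bar>c\<bar> * block_qnorm q x n"
  using assms
  by (simp add: block_qnorm_def abs_mult powr_mult powr_powr sum_nonneg flip: sum_distrib_left)

lemma block_qnorm_add:
  assumes "q > 1"
  shows "block_qnorm q (\<lambda>n i. x n i + y n i) n \<le> block_qnorm q x n + block_qnorm q y n"
proof -
  let ?A = "block_qnorm q x n" and ?B = "block_qnorm q y n"
  have "(\<Sum>i<n. \<bar>x n i + y n i\<bar> powr q) \<le> (\<Sum>i<n. (\<bar>x n i\<bar> + \<bar>y n i\<bar>) powr q)"
    using assms by (intro sum_mono powr_mono2) auto
  also have "\<dots> \<le> (?A + ?B) powr q"
    using assms by (intro minkowski_sum_le) (auto simp: block_qnorm_def powr_powr sum_nonneg)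
  finally have "block_qnorm q (\<lambda>n i. x n i + y n i) n \<le> ((?A + ?B) powr q) powr (1/q)"
    unfolding block_qnorm_def using assms by (intro powr_mono2) (auto intro: sum_nonneg)
  also have "\<dots> = ?A + ?B" using assms by (simp add: powr_powr)
  finally show ?thesis .
qed

lemma
  assumes p: "p > 1" and q: "q > 1" and x: "x \<in> lp_lq_space p q"
  shows lp_lq_space_scale: "(\<lambda>n i. c * x n i) \<in> lp_lq_space p q"
    and lp_lq_norm_scale: "lp_lq_norm p q (\<lambda>n i. c * x n i) = \<bar>c\<bar> * lp_lq_norm p q x"
proof -
  have s: "summable (\<lambda>n. block_qnorm q x n powr p)"
    using x by (simp add: lp_lq_space_def)
  show "(\<lambda>n i. c * x n i) \<in> lp_lq_space p q"
    using x q summable_mult[OF s, of "\<bar>c\<bar> powr p"]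
    by (simp add: lp_lq_space_def block_qnorm_scale powr_mult)
  show "lp_lq_norm p q (\<lambda>n i. c * x n i) = \<bar>c\<bar> * lp_lq_norm p q x"
    using p q s by (simp add: lp_lq_norm_def block_qnorm_scale powr_mult suminf_mult
        powr_powr suminf_nonneg)
qed

lemma
  assumes p: "p > 1" and q: "q > 1" and x: "x \<in> lp_lq_space p q" and y: "y \<in> lp_lq_space p q"
  shows lp_lq_space_add: "(\<lambda>n i. x n i + y n i) \<in> lp_lq_space p q"
    and lp_lq_norm_add: "lp_lq_norm p q (\<lambda>n i. x n i + y n i) \<le> lp_lq_norm p q x + lp_lq_norm p q y"
proof -
  let ?z = "\<lambda>n i. x n i + y n i"
  have sx: "summable (\<lambda>n. block_qnorm q x n powr p)"
    and sy: "summable (\<lambda>n. block_qnorm q y n powr p)"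
    using x y by (auto simp: lp_lq_space_def)
  note mink = minkowski_suminf_le[where r = p and a = "block_qnorm q x" and b = "block_qnorm q y",
      OF less_imp_le[OF p] block_qnorm_nonneg block_qnorm_nonneg sx sy]
  have le: "block_qnorm q ?z n powr p \<le> (block_qnorm q x n + block_qnorm q y n) powr p" for n
    using p block_qnorm_add[OF q, of x y] by (intro powr_mono2) auto
  have sz: "summable (\<lambda>n. block_qnorm q ?z n powr p)"
    by (rule summable_comparison_test[OF _ mink(1)]) (use le in auto)
  then show "?z \<in> lp_lq_space p q"
    using x y by (auto simp: lp_lq_space_def)
  have "lp_lq_norm p q ?z \<le> (\<Sum>n. (block_qnorm q x n + block_qnorm q y n) powr p) powr (1/p)"
    unfolding lp_lq_norm_def using p suminf_le[OF le sz mink(1)] suminf_nonneg[OF sz]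
    by (simp add: powr_mono2)
  also have "\<dots> \<le> lp_lq_norm p q x + lp_lq_norm p q y"
    using mink(2) by (simp add: lp_lq_norm_def)
  finally show "lp_lq_norm p q ?z \<le> lp_lq_norm p q x + lp_lq_norm p q y" .
qed

lemma lp_lq_space_zero: "p > 1 \<Longrightarrow> q > 1 \<Longrightarrow> (\<lambda>n i. 0) \<in> lp_lq_space p q"
  by (simp add: lp_lq_space_def block_qnorm_def)

lemma lp_lq_norm_zero: "p > 1 \<Longrightarrow> q > 1 \<Longrightarrow> lp_lq_norm p q (\<lambda>n i. 0) = 0"
  by (simp add: lp_lq_norm_def block_qnorm_def)

lemma lp_lq_norm_powr:
  assumes "p > 1" "x \<in> lp_lq_space p q"
  shows "lp_lq_norm p q x powr p = (\<Sum>n. block_qnorm q x n powr p)"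
  using assms suminf_nonneg[of "\<lambda>n. block_qnorm q x n powr p"]
  by (auto simp: lp_lq_norm_def powr_powr lp_lq_space_def)

lemma lp_lq_space_sum:
  assumes "p > 1" "q > 1" "finite J" "\<And>j. j \<in> J \<Longrightarrow> h j \<in> lp_lq_space p q"
  shows "(\<lambda>n i. \<Sum>j\<in>J. c j * h j n i) \<in> lp_lq_space p q"
  using assms(3,4)
proof (induction J)
  case (insert j J)
  then show ?case
    using assms lp_lq_space_add[OF assms(1,2) lp_lq_space_scale[OF assms(1,2), of "h j" "c j"]]
    by simp
qed (use assms in \<open>simp add: lp_lq_space_zero\<close>)

section \<open>Coefficients of polynomials in one variable\<close>

text \<open>Inversion of a Vandermonde system: the values at the nodes \<open>(1/2)^l\<close>
  determine the coefficients linearly, with weights that do not depend on the polynomial. The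
  induction removes the top degree by combining the values at a node and at its half; the top
  coefficient is then the value at 1 minus the lower coefficients.\<close>

lemma coefficient_weights_exist:
  "\<exists>w::nat \<Rightarrow> nat \<Rightarrow> real. \<forall>a::nat \<Rightarrow> real. \<forall>k\<le>N.
     a k = (\<Sum>l\<le>N. w k l * (\<Sum>d\<le>N. ((1/2)^l)^d * a d))"
proof (induction N)
  case 0
  show ?case by (rule exI[of _ "\<lambda>_ _. 1"]) simp
next
  case (Suc N)
  define p where "p = (\<lambda>(a::nat \<Rightarrow> real) l. \<Sum>d\<le>Suc N. ((1/2::real)^l)^d * a d)"
  from Suc.IH obtain w :: "nat \<Rightarrow> nat \<Rightarrow> real" where w0: "\<forall>a. \<forall>k\<le>N.
      a k = (\<Sum>l\<le>N. w k l * (\<Sum>d\<le>N. ((1/2)^l)^d * a d))" ..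
  note w = w0[rule_format]
  have low: "\<exists>v. \<forall>a. a k = (\<Sum>l\<le>Suc N. v l * p a l)" if k: "k \<le> N" for k
  proof -
    \<comment> \<open>The factor by which the combination of a node with its half multiplies the
      coefficient of degree \<open>d\<close>; it is nonzero for \<open>d \<le> N\<close> and zero
      for \<open>d = Suc N\<close>.\<close>
    define f where "f = (\<lambda>d. 1 - 2 ^ (Suc N - d) :: real)"
    have fk: "f k \<noteq> 0"
      using k one_less_power[of "2::real" "Suc N - k"] by (auto simp: f_def simp del: one_less_power)
    define v where "v = (\<lambda>l. ((if l \<le> N then w k l else 0)
        - (if l = 0 then 0 else 2 ^ Suc N * w k (l - 1))) / f k)"
    \<comment> \<open>\<open>p(\<tau>) - 2\<^bsup>N+1\<^esup> p(\<tau>/2)\<close> has no term of degree \<open>N + 1\<close>\<close>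
    have vf: "v l * f k = (if l \<le> N then w k l else 0)
        - (if l = 0 then 0 else 2 ^ Suc N * w k (l - 1))" for l
      using fk by (simp add: v_def)
    have "a k = (\<Sum>l\<le>Suc N. v l * p a l)" for a :: "nat \<Rightarrow> real"
    proof -
      have eq: "(\<Sum>d\<le>N. ((1/2)^l)^d * (a d * f d)) = p a l - 2 ^ Suc N * p a (Suc l)" for l
      proof -
        have "p a l - 2 ^ Suc N * p a (Suc l)
            = (\<Sum>d\<le>Suc N. ((1/2)^l)^d * a d - 2 ^ Suc N * (((1/2)^Suc l)^d * a d))"
          by (simp only: p_def sum_subtractf sum_distrib_left)
        also have "\<dots> = (\<Sum>d\<le>Suc N. ((1/2)^l)^d * (a d * f d))"
        proof (intro sum.cong refl)
          fix d assume "d \<in> {..Suc N}"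
          then have "(2::real) ^ Suc N = 2 ^ (Suc N - d) * 2 ^ d"
            by (simp only: power_add[symmetric] atMost_iff le_add_diff_inverse2)
          moreover have "((1/2)^Suc l)^d = ((1/2)^l)^d * (1/2::real)^d"
            by (simp only: power_Suc2 power_mult_distrib)
          moreover have "2 ^ d * (1/2::real) ^ d = 1"
            by (simp only: power_mult_distrib[symmetric]) simp
          ultimately have "2 ^ Suc N * (((1/2)^Suc l)^d * a d) = 2 ^ (Suc N - d) * (((1/2::real)^l)^d * a d)"
            by (simp only: mult_ac) (simp only: mult.assoc[symmetric])
          then show "((1/2)^l)^d * a d - 2 ^ Suc N * (((1/2)^Suc l)^d * a d) = ((1/2)^l)^d * (a d * f d)"
            unfolding f_def by (simp only: right_diff_distrib mult_1_right mult_ac)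
        qed
        also have "\<dots> = (\<Sum>d\<le>N. ((1/2)^l)^d * (a d * f d))"
          by (simp add: f_def)
        finally show ?thesis by simp
      qed
      have "a k * f k = (\<Sum>l\<le>N. w k l * (p a l - 2 ^ Suc N * p a (Suc l)))"
        using w[OF k, of "\<lambda>d. a d * f d"] by (simp only: eq)
      also have "\<dots> = (\<Sum>l\<le>N. w k l * p a l) - (\<Sum>l\<le>N. 2 ^ Suc N * w k l * p a (Suc l))"
        by (simp only: sum_subtractf right_diff_distrib mult_ac)
      also have "(\<Sum>l\<le>N. 2 ^ Suc N * w k l * p a (Suc l))
          = (\<Sum>l\<le>Suc N. (if l = 0 then 0 else 2 ^ Suc N * w k (l - 1)) * p a l)"
        by (simp only: sum.atMost_Suc_shift[of _ N] mult_zero_left simp_thms if_True diff_Suc_1 nat.distinct if_False add_0_left)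
      also have "(\<Sum>l\<le>N. w k l * p a l) = (\<Sum>l\<le>Suc N. (if l \<le> N then w k l else 0) * p a l)"
        by simp
      finally have "a k * f k = (\<Sum>l\<le>Suc N. v l * f k * p a l)"
        by (simp only: vf sum_subtractf[symmetric] left_diff_distrib[symmetric])
      also have "\<dots> = (\<Sum>l\<le>Suc N. v l * p a l) * f k"
        unfolding sum_distrib_right by (intro sum.cong) auto
      finally show ?thesis using fk by simp
    qed
    then show ?thesis by (intro exI allI)
  qed
  then have "\<forall>k. \<exists>v. k \<le> N \<longrightarrow> (\<forall>a. a k = (\<Sum>l\<le>Suc N. v l * p a l))"
    by simp
  from choice[OF this] obtain V where
    V0: "\<forall>k. k \<le> N \<longrightarrow> (\<forall>a. a k = (\<Sum>l\<le>Suc N. V k l * p a l))" ..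
  note V = V0[rule_format]
  \<comment> \<open>The node with \<open>l = 0\<close> is 1, where the polynomial equals the sum of
    all its coefficients.\<close>
  define u where "u = (\<lambda>l. (if l = 0 then 1 else 0) - (\<Sum>k\<le>N. V k l))"
  have top: "a (Suc N) = (\<Sum>l\<le>Suc N. u l * p a l)" for a
  proof -
    have "(\<Sum>l\<le>Suc N. u l * p a l)
        = (\<Sum>l\<le>Suc N. (if l = 0 then 1 else 0) * p a l) - (\<Sum>l\<le>Suc N. \<Sum>k\<le>N. V k l * p a l)"
      by (simp only: u_def left_diff_distrib sum_subtractf sum_distrib_right)
    also have "(\<Sum>l\<le>Suc N. \<Sum>k\<le>N. V k l * p a l) = (\<Sum>k\<le>N. a k)"
      by (subst sum.swap, intro sum.cong refl) (simp only: V[of _ a, symmetric] atMost_iff)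
    also have "(\<Sum>l\<le>Suc N. (if l = 0 then 1 else 0) * p a l) = p a 0"
      by (subst sum.atMost_Suc_shift) simp
    finally show ?thesis by (simp add: p_def)
  qed
  show ?case
  proof (intro exI allI impI)
    fix a :: "nat \<Rightarrow> real" and k assume k: "k \<le> Suc N"
    show "a k = (\<Sum>l\<le>Suc N. (if k = Suc N then u else V k) l * (\<Sum>d\<le>Suc N. ((1/2)^l)^d * a d))"
    proof (cases "k = Suc N")
      case True
      show ?thesis unfolding True using top[of a, unfolded p_def] by (simp only: simp_thms if_True)
    next
      case False
      then have "k \<le> N" using k by simp
      from V[OF this, of a, unfolded p_def] False show ?thesis by (simp only: if_False)
    qed
  qed
qed

definition coefficient_weight :: "nat \<Rightarrow> nat \<Rightarrow> nat \<Rightarrow> real" where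
  "coefficient_weight N = (SOME w. \<forall>a::nat \<Rightarrow> real. \<forall>k\<le>N.
     a k = (\<Sum>l\<le>N. w k l * (\<Sum>d\<le>N. ((1/2)^l)^d * a d)))"

lemma coefficient_weight:
  assumes "k \<le> N"
  shows "(\<Sum>l\<le>N. coefficient_weight N k l * (\<Sum>d\<le>N. ((1/2)^l)^d * a d)) = a k"
  using someI_ex[OF coefficient_weights_exist[of N], folded coefficient_weight_def,
      rule_format, OF assms, of a] by (rule sym)

text \<open>Summing over all \<open>k\<close> gives one constant for every coefficient; the summand
  1 keeps it positive.\<close>

definition coefficient_bound :: "nat \<Rightarrow> real" where
  "coefficient_bound N = 1 + (\<Sum>k\<le>N. \<Sum>l\<le>N. \<bar>coefficient_weight N k l\<bar>)"

lemma coefficient_bound_ge_1: "1 \<le> coefficient_bound N"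
  by (simp add: coefficient_bound_def sum_nonneg)

lemma weighted_sum_bound:
  assumes "k \<le> N" and b: "\<And>l. l \<le> N \<Longrightarrow> \<bar>b l\<bar> \<le> C"
  shows "\<bar>\<Sum>l\<le>N. coefficient_weight N k l * b l\<bar> \<le> coefficient_bound N * C"
proof -
  have C: "0 \<le> C" using b[of 0] by simp
  have "\<bar>\<Sum>l\<le>N. coefficient_weight N k l * b l\<bar> \<le> (\<Sum>l\<le>N. \<bar>coefficient_weight N k l * b l\<bar>)"
    by (rule sum_abs)
  also have "\<dots> \<le> (\<Sum>l\<le>N. \<bar>coefficient_weight N k l\<bar> * C)"
    using b by (intro sum_mono) (auto simp: abs_mult intro: mult_left_mono)
  also have "\<dots> = (\<Sum>l\<le>N. \<bar>coefficient_weight N k l\<bar>) * C"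
    by (simp add: sum_distrib_right)
  also have "(\<Sum>l\<le>N. \<bar>coefficient_weight N k l\<bar>) \<le> (\<Sum>k\<le>N. \<Sum>l\<le>N. \<bar>coefficient_weight N k l\<bar>)"
    using member_le_sum[of k "{..N}" "\<lambda>k. \<Sum>l\<le>N. \<bar>coefficient_weight N k l\<bar>"] assms(1)
    by (simp add: sum_nonneg)
  also have "\<dots> \<le> coefficient_bound N" by (simp add: coefficient_bound_def)
  finally show ?thesis using C by (simp add: mult_right_mono)
qed

text \<open>A Markov-type inequality: the nodes \<open>(1/2)^l\<close> lie in the unit interval, so
  a bound there controls each coefficient up to a constant depending only on the degree
  bound.\<close>

lemma coefficient_bounded:
  assumes "k \<le> N" and "\<And>t. 0 \<le> t \<Longrightarrow> t \<le> 1 \<Longrightarrow> \<bar>\<Sum>d\<le>N. t ^ d * a d\<bar> \<le> C"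
  shows "\<bar>a k\<bar> \<le> coefficient_bound N * C"
  using weighted_sum_bound[OF assms(1), of "\<lambda>l. \<Sum>d\<le>N. ((1/2)^l)^d * a d" C] assms
  by (simp add: coefficient_weight power_le_one)

section \<open>Taylor coefficients of polynomials on sequences\<close>

definition linear_subspace :: "blockseq set \<Rightarrow> bool" where
  "linear_subspace S \<longleftrightarrow> (\<lambda>n i. 0) \<in> S \<and> (\<forall>x\<in>S. \<forall>y\<in>S. \<forall>a b. lincomb a x b y \<in> S)"

definition vec_sum :: "('j \<Rightarrow> real) \<Rightarrow> ('j \<Rightarrow> blockseq) \<Rightarrow> 'j set \<Rightarrow> blockseq" where
  "vec_sum c h J = (\<lambda>n i. \<Sum>j\<in>J. c j * h j n i)"

lemma vec_sum_empty: "vec_sum c h {} = (\<lambda>n i. 0)"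
  by (simp add: vec_sum_def)

lemma vec_sum_insert:
  "finite J \<Longrightarrow> j \<notin> J \<Longrightarrow> vec_sum c h (insert j J) = lincomb (c j) (h j) 1 (vec_sum c h J)"
  by (simp add: vec_sum_def lincomb_def)

lemma vec_sum_in_subspace:
  assumes "linear_subspace S" "finite J" "\<And>j. j \<in> J \<Longrightarrow> h j \<in> S"
  shows "vec_sum c h J \<in> S"
  using assms(2,3)
  by (induction J) (use assms(1) in \<open>auto simp: vec_sum_empty vec_sum_insert linear_subspace_def\<close>)

text \<open>The forms are not assumed symmetric, so a multilinear expansion has one term per ordered
  choice of vectors, that is, per word.\<close>

definition words :: "'j set \<Rightarrow> nat \<Rightarrow> 'j list set" where
  "words J k = {I. set I \<subseteq> J \<and> length I = k}"

lemma finite_words [simp]: "finite J \<Longrightarrow> finite (words J k)"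
  unfolding words_def by (rule finite_lists_length_eq)

lemma sum_words_Suc:
  "(\<Sum>I\<in>words J (Suc k). f I) = (\<Sum>j\<in>J. \<Sum>I\<in>words J k. f (j # I))"
proof -
  have "(\<Sum>j\<in>J. \<Sum>I\<in>words J k. f (j # I)) = (\<Sum>(j,I)\<in>J \<times> words J k. f (j # I))"
    by (rule sum.cartesian_product)
  also have "\<dots> = (\<Sum>I\<in>words J (Suc k). f I)"
    by (rule sum.reindex_bij_witness[where i = "\<lambda>I. (hd I, tl I)" and j = "\<lambda>(j,I). j # I"])
      (auto simp: words_def length_Suc_conv)
  finally show ?thesis by simp
qed

lemma multilinear_slot_sum:
  assumes A: "multilinear_on S m A" and S: "linear_subspace S" and fin: "finite J"
    and h: "\<And>j. j \<in> J \<Longrightarrow> h j \<in> S" and us: "set us \<subseteq> S" and vs: "set vs \<subseteq> S"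
    and len: "length us + Suc (length vs) = m"
  shows "A (us @ vec_sum c h J # vs) = (\<Sum>j\<in>J. c j * A (us @ h j # vs))"
proof -
  have lin: "A (us @ lincomb a u b v # vs) = a * A (us @ u # vs) + b * A (us @ v # vs)"
    if "u \<in> S" "v \<in> S" for a u b v
  proof -
    have "length (us @ u # vs) = m \<and> set (us @ u # vs) \<subseteq> S" "length us < m"
      using us vs len that by auto
    then show ?thesis
      using A that unfolding multilinear_on_def
      by (metis list_update_length)
  qed
  show ?thesis
    using fin h
  proof (induction J)
    case empty
    \<comment> \<open>Multilinearity speaks of two-term combinations only, so the empty sum is
      written as one with both coefficients 0.\<close>
    have "vec_sum c h {} = lincomb 0 (\<lambda>n i. 0) 0 (\<lambda>n i. 0)"
      by (simp add: vec_sum_empty lincomb_def)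
    then show ?case using lin[of "\<lambda>n i. 0" "\<lambda>n i. 0" 0 0] S
      by (simp add: linear_subspace_def)
  next
    case (insert j J)
    then show ?case
      using lin[of "h j" "vec_sum c h J" "c j" 1] vec_sum_in_subspace[OF S, of J h c]
      by (simp add: vec_sum_insert)
  qed
qed

lemma multilinear_expand:
  assumes A: "multilinear_on S m A" and S: "linear_subspace S" and fin: "finite J"
    and h: "\<And>j. j \<in> J \<Longrightarrow> h j \<in> S" 
  shows "A (replicate m (vec_sum c h J)) = (\<Sum>I\<in>words J m. prod_list (map c I) * A (map h I))"
proof -
  \<comment> \<open>Slots are expanded from left to right; \<open>us\<close> holds the vectors
    already chosen.\<close>
  have "A (us @ replicate k (vec_sum c h J))
      = (\<Sum>I\<in>words J k. prod_list (map c I) * A (us @ map h I))"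
    if "set us \<subseteq> S" "length us + k = m" for us k
    using that
  proof (induction k arbitrary: us)
    case 0
    have "words J 0 = {[]}" by (auto simp: words_def)
    then show ?case by simp
  next
    case (Suc k)
    have v: "vec_sum c h J \<in> S"
      using vec_sum_in_subspace[OF S fin h] by simp
    have "A (us @ replicate (Suc k) (vec_sum c h J))
        = (\<Sum>j\<in>J. c j * A ((us @ [h j]) @ replicate k (vec_sum c h J)))"
      using multilinear_slot_sum[OF A S fin h, where us = us and vs = "replicate k (vec_sum c h J)" and c = c] Suc.prems v
      by (simp add: set_replicate_conv_if)
    also have "\<dots> = (\<Sum>j\<in>J. \<Sum>I\<in>words J k. prod_list (map c (j # I)) * A (us @ map h (j # I)))"
    proof (intro sum.cong refl)
      fix j assume "j \<in> J"
      then show "c j * A ((us @ [h j]) @ replicate k (vec_sum c h J))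
          = (\<Sum>I\<in>words J k. prod_list (map c (j # I)) * A (us @ map h (j # I)))"
        using Suc.IH[of "us @ [h j]"] Suc.prems h by (simp add: sum_distrib_left mult.assoc)
    qed
    finally show ?case by (simp add: sum_words_Suc)
  qed
  from this[of "[]" m] show ?thesis by simp
qed

text \<open>This is \<open>polynomial_on\<close> with the degree bound exposed, because the
  interpolation weights depend on it.\<close>

definition polynomial_le :: "blockseq set \<Rightarrow> nat \<Rightarrow> (blockseq \<Rightarrow> real) \<Rightarrow> bool" where
  "polynomial_le S N P \<longleftrightarrow> (\<exists>A. (\<forall>k\<le>N. multilinear_on S k (A k)) \<and>
            (\<forall>x\<in>S. P x = (\<Sum>k\<le>N. A k (replicate k x))))"

text \<open>A word over \<open>option\<close> marks with \<open>None\<close> the slots occupied by the base point \<open>x\<close>;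
  deleting these marks groups the expansion of \<open>P (x + t * h)\<close> by powers of \<open>t\<close>.\<close>

lemma polynomial_le_expand:
  fixes h :: "'j \<Rightarrow> blockseq"
  assumes P: "polynomial_le S N P" and S: "linear_subspace S" and fin: "finite J"
    and h: "\<And>j. j \<in> J \<Longrightarrow> h j \<in> S" and x: "x \<in> S"
  shows "\<exists>a. \<forall>c t. P (lincomb 1 x t (vec_sum c h J))
      = (\<Sum>k\<le>N. t ^ k * (\<Sum>I\<in>words J k. a I * prod_list (map c I)))"
proof -
  from P[unfolded polynomial_le_def] obtain A where
    PA': "(\<forall>k\<le>N. multilinear_on S k (A k)) \<and> (\<forall>x\<in>S. P x = (\<Sum>k\<le>N. A k (replicate k x)))" ..
  note A = PA'[THEN conjunct1, rule_format] and PA = PA'[THEN conjunct2, rule_format]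
  define J' where "J' = insert None (Some ` J)"
  define h' where "h' = (\<lambda>z. case z of None \<Rightarrow> x | Some j \<Rightarrow> h j)"
  define del where "del = (\<lambda>I::'j option list. map the (filter (\<lambda>z. z \<noteq> None) I))"
  define T where "T = (SIGMA m:{..N}. words J' m)"
  define U where "U = (SIGMA k:{..N}. words J k)"
  \<comment> \<open>All slot words that reduce to \<open>I\<close> are collected here, whatever
    their length. Neither \<open>c\<close> nor \<open>t\<close> enters, so one \<open>a\<close>
    serves all scalars.\<close>
  define a where "a = (\<lambda>I. \<Sum>(m,I')\<in>{z\<in>T. del (snd z) = I}. A m (map h' I'))"
  have finT: "finite T" and finU: "finite U"
    using fin by (auto simp: T_def U_def J'_def)
  have len_del: "length (del I) \<le> length I" for I
    by (simp add: del_def)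
  have TU: "(\<lambda>z. (length (del (snd z)), del (snd z))) ` T \<subseteq> U"
  proof clarify
    fix m I assume "(m, I) \<in> T"
    then have "length I \<le> N" "set I \<subseteq> J'" by (auto simp: T_def words_def)
    then show "(length (del (snd (m, I))), del (snd (m, I))) \<in> U"
      using len_del[of I] by (auto simp: U_def words_def) (auto simp: del_def J'_def)
  qed
  have "P (lincomb 1 x t (vec_sum c h J))
      = (\<Sum>k\<le>N. t ^ k * (\<Sum>I\<in>words J k. a I * prod_list (map c I)))" for c t
  proof -
    define c' where "c' = (\<lambda>z. case z of None \<Rightarrow> 1 | Some j \<Rightarrow> t * c j)"
    have v: "lincomb 1 x t (vec_sum c h J) = vec_sum c' h' J'"
    proof -
      have "(\<Sum>z\<in>Some ` J. c' z * h' z n i) = (\<Sum>j\<in>J. t * c j * h j n i)" for n i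
        by (subst sum.reindex) (auto simp: c'_def h'_def)
      then show ?thesis
        using fin by (simp add: vec_sum_def lincomb_def J'_def c'_def h'_def sum_distrib_left mult.assoc)
    qed
    have h'S: "h' z \<in> S" if "z \<in> J'" for z
      using that h x by (auto simp: h'_def J'_def)
    have finJ': "finite J'" using fin by (simp add: J'_def)
    have prod: "prod_list (map c' I) = t ^ length (del I) * prod_list (map c (del I))" for I
      by (induction I) (auto simp: del_def c'_def split: option.split)
    have "P (lincomb 1 x t (vec_sum c h J)) = (\<Sum>m\<le>N. A m (replicate m (vec_sum c' h' J')))"
      unfolding v by (rule PA) (use vec_sum_in_subspace[OF S finJ' h'S] in simp)
    also have "\<dots> = (\<Sum>m\<le>N. \<Sum>I\<in>words J' m. prod_list (map c' I) * A m (map h' I))"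
      using multilinear_expand[OF A S finJ' h'S] by (intro sum.cong) auto
    also have "\<dots> = (\<Sum>(m,I)\<in>T. prod_list (map c' I) * A m (map h' I))"
      unfolding T_def using finJ' by (subst sum.Sigma) auto
    also have "\<dots> = (\<Sum>u\<in>U. \<Sum>z\<in>{z\<in>T. (length (del (snd z)), del (snd z)) = u}.
        (case z of (m,I) \<Rightarrow> prod_list (map c' I) * A m (map h' I)))"
      by (rule sum.group[OF finT finU TU, symmetric])
    also have "\<dots> = (\<Sum>(k,I)\<in>U. t ^ k * (a I * prod_list (map c I)))"
    proof (intro sum.cong refl)
      fix u assume "u \<in> U"
      then obtain k I where u: "u = (k, I)" "length I = k" by (auto simp: U_def words_def)
      have "{z\<in>T. (length (del (snd z)), del (snd z)) = u} = {z\<in>T. del (snd z) = I}"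
        using u by auto
      then show "(\<Sum>z\<in>{z\<in>T. (length (del (snd z)), del (snd z)) = u}.
          (case z of (m,I) \<Rightarrow> prod_list (map c' I) * A m (map h' I)))
        = (case u of (k,I) \<Rightarrow> t ^ k * (a I * prod_list (map c I)))"
        using u by (auto simp: a_def prod sum_distrib_left sum_distrib_right mult_ac intro!: sum.cong)
    qed
    also have "\<dots> = (\<Sum>k\<le>N. \<Sum>I\<in>words J k. t ^ k * (a I * prod_list (map c I)))"
      unfolding U_def using fin by (subst sum.Sigma) auto
    finally show ?thesis by (simp add: sum_distrib_left)
  qed
  then show ?thesis by (intro exI allI)
qed

text \<open>The coefficient of \<open>t ^ k\<close> in \<open>P (x + t * h)\<close>, obtained by
  interpolation from values of \<open>P\<close>. Bounds on \<open>P\<close> thereby become bounds on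
  the coefficient directly.\<close>

definition taylor_coeff :: "nat \<Rightarrow> (blockseq \<Rightarrow> real) \<Rightarrow> nat \<Rightarrow> blockseq \<Rightarrow> blockseq \<Rightarrow> real" where
  "taylor_coeff N P k x h = (\<Sum>l\<le>N. coefficient_weight N k l * P (lincomb 1 x ((1/2)^l) h))"

text \<open>For a fixed base point the coefficient is a homogeneous polynomial of degree
  \<open>k\<close> in the scalars \<open>c\<close>. One function \<open>a\<close> covers all orders,
  since the length of a word determines its order.\<close>

lemma taylor_coeff_vec_sum:
  assumes "polynomial_le S N P" "linear_subspace S" "finite J" "\<And>j. j \<in> J \<Longrightarrow> h j \<in> S" "x \<in> S"
  shows "\<exists>a. \<forall>c. \<forall>k\<le>N. taylor_coeff N P k x (vec_sum c h J)
      = (\<Sum>I\<in>words J k. a I * prod_list (map c I))"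
proof -
  from polynomial_le_expand[OF assms] obtain a where "\<forall>c t. P (lincomb 1 x t (vec_sum c h J))
      = (\<Sum>k\<le>N. t ^ k * (\<Sum>I\<in>words J k. a I * prod_list (map c I)))" ..
  note a = this[rule_format]
  show ?thesis
    by (intro exI[of _ a] allI impI) (simp only: taylor_coeff_def a coefficient_weight)
qed

text \<open>Over a one-element index set there is exactly one word of each length, so the general
  expansion collapses to a polynomial in \<open>t\<close> whose coefficients are homogeneous in
  \<open>h\<close>.\<close>

lemma
  assumes P: "polynomial_le S N P" and S: "linear_subspace S" and h: "h \<in> S" and x: "x \<in> S"
  shows taylor_expansion: "P (lincomb 1 x t h) = (\<Sum>k\<le>N. t ^ k * taylor_coeff N P k x h)"
    and taylor_coeff_scale: "k \<le> N \<Longrightarrow>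
      taylor_coeff N P k x (\<lambda>n i. s * h n i) = s ^ k * taylor_coeff N P k x h"
proof -
  have "\<exists>a. \<forall>c t. P (lincomb 1 x t (vec_sum c (\<lambda>_. h) {()}))
      = (\<Sum>k\<le>N. t ^ k * (\<Sum>I\<in>words {()} k. a I * prod_list (map c I)))"
    by (rule polynomial_le_expand[OF P S]) (use h x in auto)
  then obtain a where "\<forall>c t. P (lincomb 1 x t (vec_sum c (\<lambda>_. h) {()}))
      = (\<Sum>k\<le>N. t ^ k * (\<Sum>I\<in>words {()} k. a I * prod_list (map c I)))" ..
  note a = this[rule_format]
  have words: "words {()} k = {replicate k ()}" for k
    by (auto simp: words_def intro: replicate_eqI)
  have v: "vec_sum c (\<lambda>_. h) {()} = (\<lambda>n i. c () * h n i)" for c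
    by (simp add: vec_sum_def)
  have *: "P (lincomb 1 x t (\<lambda>n i. s * h n i)) = (\<Sum>k\<le>N. t ^ k * (s ^ k * a (replicate k ())))" for s t
    using a[of t "\<lambda>_. s"] by (simp add: words v mult_ac prod_list_replicate)
  have coeff: "taylor_coeff N P k x (\<lambda>n i. s * h n i) = s ^ k * a (replicate k ())" if "k \<le> N" for k s
    using that by (simp only: taylor_coeff_def * coefficient_weight)
  have coeff1: "taylor_coeff N P k x h = a (replicate k ())" if "k \<le> N" for k
    using coeff[OF that, of 1] by simp
  show "k \<le> N \<Longrightarrow> taylor_coeff N P k x (\<lambda>n i. s * h n i) = s ^ k * taylor_coeff N P k x h"
    by (simp add: coeff coeff1)
  show "P (lincomb 1 x t h) = (\<Sum>k\<le>N. t ^ k * taylor_coeff N P k x h)"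
    using *[of t 1] by (simp add: coeff1)
qed

section \<open>Averages over random subsets\<close>

text \<open>The expectation of \<open>F\<close> at a random subset of \<open>J\<close> that contains
  each element independently with probability \<theta>.\<close>

definition bernoulli_mean :: "real \<Rightarrow> 'j set \<Rightarrow> ('j set \<Rightarrow> real) \<Rightarrow> real" where
  "bernoulli_mean \<theta> J F = (\<Sum>B\<in>Pow J. \<theta> ^ card B * (1 - \<theta>) ^ card (J - B) * F B)"

text \<open>By independence, the elements of \<open>S\<close> must all be selected and the others
  are free. In the product expansion, the weight for omitting an element of \<open>S\<close> is set
  to 0.\<close>

lemma bernoulli_mean_superset:
  assumes "finite J" "S \<subseteq> J"
  shows "bernoulli_mean \<theta> J (\<lambda>B. of_bool (S \<subseteq> B)) = \<theta> ^ card S"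
proof -
  have "bernoulli_mean \<theta> J (\<lambda>B. of_bool (S \<subseteq> B))
      = (\<Sum>B\<in>Pow J. (\<Prod>x\<in>B. \<theta>) * (\<Prod>x\<in>J - B. if x \<in> S then 0 else 1 - \<theta>))"
    unfolding bernoulli_mean_def
  proof (intro sum.cong refl)
    fix B assume B: "B \<in> Pow J"
    show "\<theta> ^ card B * (1 - \<theta>) ^ card (J - B) * of_bool (S \<subseteq> B)
        = (\<Prod>x\<in>B. \<theta>) * (\<Prod>x\<in>J - B. if x \<in> S then 0 else 1 - \<theta>)"
    proof (cases "S \<subseteq> B")
      case True
      then have "(\<Prod>x\<in>J - B. if x \<in> S then 0 else 1 - \<theta>) = (\<Prod>x\<in>J - B. 1 - \<theta>)"
        by (intro prod.cong) auto
      then show ?thesis using True by simp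
    next
      case False
      then have "(\<Prod>x\<in>J - B. if x \<in> S then 0 else 1 - \<theta>) = 0"
        using assms by (intro prod_zero) auto
      then show ?thesis using False by simp
    qed
  qed
  also have "\<dots> = (\<Prod>x\<in>J. \<theta> + (if x \<in> S then 0 else 1 - \<theta>))"
    using assms(1) by (rule prod_add[symmetric])
  also have "\<dots> = (\<Prod>x\<in>J. if x \<in> S then \<theta> else 1)"
    by (intro prod.cong) auto
  also have "\<dots> = (\<Prod>x\<in>S. \<theta>)"
    using assms by (simp add: prod.If_cases Int_absorb1)
  finally show ?thesis by simp
qed

lemma bernoulli_mean_mono:
  assumes "0 \<le> \<theta>" "\<theta> \<le> 1" "\<And>B. B \<subseteq> J \<Longrightarrow> F B \<le> G B"
  shows "bernoulli_mean \<theta> J F \<le> bernoulli_mean \<theta> J G"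
  unfolding bernoulli_mean_def using assms by (intro sum_mono mult_left_mono) auto

lemma bernoulli_mean_cmult:
  "bernoulli_mean \<theta> J (\<lambda>B. c * F B) = c * bernoulli_mean \<theta> J F"
  by (simp add: bernoulli_mean_def sum_distrib_left mult_ac)

lemma bernoulli_mean_const:
  "finite J \<Longrightarrow> bernoulli_mean \<theta> J (\<lambda>B. c) = c"
  using bernoulli_mean_superset[of J "{}" \<theta>] bernoulli_mean_cmult[of \<theta> J c "\<lambda>_. 1"] by simp

text \<open>The size of the random subset is binomially distributed; this turns the mean into a
  Bernstein polynomial and makes Bernstein's approximation theorem applicable.\<close>

lemma bernoulli_mean_card:
  "bernoulli_mean \<theta> {..<L} (\<lambda>B. f (card B)) = (\<Sum>k\<le>L. f k * Bernstein L k \<theta>)"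
proof -
  have "bernoulli_mean \<theta> {..<L} (\<lambda>B. f (card B))
      = (\<Sum>k\<le>L. \<Sum>B\<in>{B\<in>Pow {..<L}. card B = k}. \<theta> ^ card B * (1 - \<theta>) ^ card ({..<L} - B) * f (card B))"
    unfolding bernoulli_mean_def
    by (rule sum.group[symmetric]) (auto dest: card_mono[rotated])
  also have "\<dots> = (\<Sum>k\<le>L. f k * Bernstein L k \<theta>)"
  proof (intro sum.cong refl)
    fix k assume "k \<in> {..L}"
    have "(\<Sum>B\<in>{B\<in>Pow {..<L}. card B = k}. \<theta> ^ card B * (1 - \<theta>) ^ card ({..<L} - B) * f (card B))
        = (\<Sum>B\<in>{B\<in>Pow {..<L}. card B = k}. \<theta> ^ k * (1 - \<theta>) ^ (L - k) * f k)"
    proof (intro sum.cong refl)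
      fix B assume B: "B \<in> {B\<in>Pow {..<L}. card B = k}"
      then have "card ({..<L} - B) = L - k"
        using card_Diff_subset[of B "{..<L}"] finite_subset[of B "{..<L}"] by auto
      then show "\<theta> ^ card B * (1 - \<theta>) ^ card ({..<L} - B) * f (card B)
          = \<theta> ^ k * (1 - \<theta>) ^ (L - k) * f k" using B by simp
    qed
    also have "\<dots> = f k * Bernstein L k \<theta>"
      using n_subsets[of "{..<L}" k] by (simp add: Bernstein_def Pow_def)
    finally show "(\<Sum>B\<in>{B\<in>Pow {..<L}. card B = k}.
        \<theta> ^ card B * (1 - \<theta>) ^ card ({..<L} - B) * f (card B)) = f k * Bernstein L k \<theta>" .
  qed
  finally show ?thesis .
qed

lemma prod_list_indicator:
  "prod_list (map (indicator B :: _ \<Rightarrow> real) I) = of_bool (set I \<subseteq> B)"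
  by (induction I) (auto simp: indicator_def)

text \<open>A homogeneous form of degree \<open>k\<close> evaluated at the indicator vector of
  \<open>B\<close>: only words with all letters in \<open>B\<close> survive.\<close>

definition word_poly :: "'j set \<Rightarrow> nat \<Rightarrow> ('j list \<Rightarrow> real) \<Rightarrow> 'j set \<Rightarrow> real" where
  "word_poly J k a B = (\<Sum>I\<in>words J k. a I * prod_list (map (indicator B) I))"

text \<open>A word survives with probability \<theta> to the number of its distinct letters, which
  is at most \<open>k\<close>. The degree in \<theta> therefore stays bounded however large
  \<open>J\<close> is.\<close>

lemma bernoulli_mean_word_poly:
  assumes "finite J"
  shows "bernoulli_mean \<theta> J (word_poly J k a)
      = (\<Sum>d\<le>k. \<theta> ^ d * (\<Sum>I\<in>{I\<in>words J k. card (set I) = d}. a I))"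
proof -
  have "bernoulli_mean \<theta> J (word_poly J k a)
      = (\<Sum>I\<in>words J k. a I * bernoulli_mean \<theta> J (\<lambda>B. of_bool (set I \<subseteq> B)))"
    unfolding bernoulli_mean_def word_poly_def prod_list_indicator sum_distrib_left
    by (subst sum.swap) (simp add: mult_ac)
  also have "\<dots> = (\<Sum>I\<in>words J k. a I * \<theta> ^ card (set I))"
    using assms by (intro sum.cong) (auto simp: bernoulli_mean_superset words_def)
  also have "\<dots> = (\<Sum>d\<le>k. \<Sum>I\<in>{I\<in>words J k. card (set I) = d}. a I * \<theta> ^ card (set I))"
    using assms by (intro sum.group[symmetric] finite_words) (auto simp: words_def card_length)
  also have "\<dots> = (\<Sum>d\<le>k. \<theta> ^ d * (\<Sum>I\<in>{I\<in>words J k. card (set I) = d}. a I))"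
    by (intro sum.cong refl) (auto simp: sum_distrib_left mult.commute intro!: sum.cong)
  finally show ?thesis .
qed

lemma word_poly_singleton:
  assumes "finite J" "j \<in> J"
  shows "word_poly J k a {j} = a (replicate k j)"
proof -
  have "word_poly J k a {j} = (\<Sum>I\<in>{I\<in>words J k. set I \<subseteq> {j}}. a I)"
    unfolding word_poly_def prod_list_indicator using assms
    by (intro sum.mono_neutral_cong_right) auto
  also have "{I\<in>words J k. set I \<subseteq> {j}} = {replicate k j}"
    using assms by (auto simp: words_def intro!: replicate_eqI)
  finally show ?thesis by simp
qed

text \<open>The sum over singletons is the linear coefficient in \<open>\<theta>\<close> of the Bernoulli mean.\<close>

lemma word_poly_sum_singletons:
  assumes fin: "finite J" and k: "1 \<le> k"
    and bound: "\<And>B. B \<subseteq> J \<Longrightarrow> \<bar>word_poly J k a B\<bar> \<le> C"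
  shows "\<bar>\<Sum>j\<in>J. word_poly J k a {j}\<bar> \<le> coefficient_bound k * C"
proof -
  have "\<bar>\<Sum>I\<in>{I\<in>words J k. card (set I) = 1}. a I\<bar> \<le> coefficient_bound k * C"
  proof (rule coefficient_bounded[OF k])
    fix t :: real assume t: "0 \<le> t" "t \<le> 1"
    have "word_poly J k a B \<le> C" "- C \<le> word_poly J k a B" if "B \<subseteq> J" for B
      using bound[OF that] by auto
    then have "bernoulli_mean t J (word_poly J k a) \<le> C" "- C \<le> bernoulli_mean t J (word_poly J k a)"
      using t bernoulli_mean_mono[of t J "word_poly J k a" "\<lambda>_. C"]
        bernoulli_mean_mono[of t J "\<lambda>_. - C" "word_poly J k a"]
      by (auto simp: bernoulli_mean_const fin)
    then show "\<bar>\<Sum>d\<le>k. t ^ d * (\<Sum>I\<in>{I\<in>words J k. card (set I) = d}. a I)\<bar> \<le> C"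
      using bernoulli_mean_word_poly[OF fin, of t k a] by linarith
  qed
  moreover have "(\<Sum>I\<in>{I\<in>words J k. card (set I) = 1}. a I) = (\<Sum>j\<in>J. a (replicate k j))"
  proof (rule sum.reindex_bij_witness[where i = "\<lambda>j. replicate k j" and j = hd])
    fix I assume "I \<in> {I\<in>words J k. card (set I) = 1}"
    then obtain j where I: "set I = {j}" "length I = k" "set I \<subseteq> J"
      by (auto simp: words_def card_1_singleton_iff)
    then have "I = replicate k j" by (intro replicate_eqI) auto
    moreover have "j \<in> J" using I by auto
    ultimately show "replicate k (hd I) = I" "hd I \<in> J" "a (replicate k (hd I)) = a I"
      using k by (auto simp: hd_replicate)
  qed (use k in \<open>auto simp: words_def hd_replicate\<close>)
  moreover have "(\<Sum>j\<in>J. word_poly J k a {j}) = (\<Sum>j\<in>J. a (replicate k j))"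
    using fin by (intro sum.cong) (auto simp: word_poly_singleton)
  ultimately show ?thesis by simp
qed

definition set_sum :: "('j \<Rightarrow> blockseq) \<Rightarrow> 'j set \<Rightarrow> blockseq" where
  "set_sum h B = (\<lambda>n i. \<Sum>j\<in>B. h j n i)"

lemma vec_sum_indicator:
  assumes "finite J" "B \<subseteq> J"
  shows "vec_sum (indicator B) h J = set_sum h B"
  using assms by (auto simp: vec_sum_def set_sum_def indicator_def fun_eq_iff Int_absorb1
      if_distrib[of "\<lambda>c. c * _"] sum.If_cases intro!: sum.cong)

lemma taylor_coeff_set_sum:
  assumes "polynomial_le S N P" "linear_subspace S" "finite J" "\<And>j. j \<in> J \<Longrightarrow> h j \<in> S" "x \<in> S"
    and k: "k \<le> N"
  shows "\<exists>a. \<forall>B. B \<subseteq> J \<longrightarrow> taylor_coeff N P k x (set_sum h B) = word_poly J k a B"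
proof -
  from taylor_coeff_vec_sum[OF assms(1-5)] obtain a where "\<forall>c. \<forall>k\<le>N.
      taylor_coeff N P k x (vec_sum c h J) = (\<Sum>I\<in>words J k. a I * prod_list (map c I))" ..
  note a = this[rule_format, OF k]
  have "taylor_coeff N P k x (set_sum h B) = word_poly J k a B" if "B \<subseteq> J" for B
    using a[of "indicator B"] vec_sum_indicator[OF assms(3) that, of h] by (simp add: word_poly_def)
  then show ?thesis by (intro exI allI impI)
qed

text \<open>Boundedness on all partial sums of the vectors controls the sum of the absolute
  coefficients at single vectors. The singleton bound is applied separately to the indices with
  nonnegative and with negative coefficient, whence the factor 2.\<close>

lemma taylor_coeff_sum_abs:
  fixes h :: "'j \<Rightarrow> blockseq"
  assumes P: "polynomial_le S N P" and S: "linear_subspace S" and fin: "finite J"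
    and h: "\<And>j. j \<in> J \<Longrightarrow> h j \<in> S" and x: "x \<in> S" and k: "1 \<le> k" "k \<le> N"
    and bound: "\<And>B. B \<subseteq> J \<Longrightarrow> \<bar>taylor_coeff N P k x (set_sum h B)\<bar> \<le> C"
  shows "(\<Sum>j\<in>J. \<bar>taylor_coeff N P k x (h j)\<bar>) \<le> 2 * (coefficient_bound k * C)"
proof -
  define f where "f = (\<lambda>j. taylor_coeff N P k x (h j))"
  have part: "\<bar>\<Sum>j\<in>J'. f j\<bar> \<le> coefficient_bound k * C" if J': "J' \<subseteq> J" for J'
  proof -
    have fin': "finite J'" using fin J' finite_subset by blast
    have "\<exists>a. \<forall>B. B \<subseteq> J' \<longrightarrow> taylor_coeff N P k x (set_sum h B) = word_poly J' k a B"
      by (rule taylor_coeff_set_sum[OF P S fin' _ x k(2)]) (use h J' in auto)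
    then obtain a where "\<forall>B. B \<subseteq> J' \<longrightarrow> taylor_coeff N P k x (set_sum h B) = word_poly J' k a B" ..
    note a = this[rule_format]
    have "\<bar>\<Sum>j\<in>J'. word_poly J' k a {j}\<bar> \<le> coefficient_bound k * C"
    proof (rule word_poly_sum_singletons[OF fin' k(1)])
      fix B assume B: "B \<subseteq> J'"
      then have "B \<subseteq> J" using J' by blast
      from bound[OF this] show "\<bar>word_poly J' k a B\<bar> \<le> C" by (simp only: a[OF B])
    qed
    moreover have "word_poly J' k a {j} = f j" if "j \<in> J'" for j
    proof -
      have "set_sum h {j} = h j" by (simp add: set_sum_def)
      then show ?thesis using a[of "{j}"] that by (simp add: f_def)
    qed
    ultimately show ?thesis by simp
  qed
  have "(\<Sum>j\<in>J. \<bar>f j\<bar>) = (\<Sum>j\<in>J. if 0 \<le> f j then f j else - f j)"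
    by (intro sum.cong) auto
  also have "\<dots> = (\<Sum>j\<in>J \<inter> {j. 0 \<le> f j}. f j) + (\<Sum>j\<in>J \<inter> - {j. 0 \<le> f j}. - f j)"
    by (rule sum.If_cases[OF fin])
  also have "\<dots> \<le> 2 * (coefficient_bound k * C)"
    using part[of "J \<inter> {j. 0 \<le> f j}"] part[of "J \<inter> - {j. 0 \<le> f j}"]
    by (simp add: sum_negf)
  finally show ?thesis by (simp add: f_def)
qed

section \<open>Polynomials comparable to a real power\<close>

lemma small_powr:
  fixes M e \<sigma> :: real
  assumes "\<sigma> > 0" "e > 0" "M \<ge> 0"
  shows "\<exists>\<theta>>0. \<theta> < 1 \<and> M * \<theta> powr \<sigma> \<le> e"
proof -
  define u where "u = (e / (M + 1)) powr (1 / \<sigma>)"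
  define \<theta> where "\<theta> = min (1/2) u"
  have u: "u > 0" "u powr \<sigma> = e / (M + 1)" using assms by (auto simp: u_def powr_powr)
  have "\<theta> powr \<sigma> \<le> u powr \<sigma>" using assms u by (intro powr_mono2) (auto simp: \<theta>_def)
  then have "M * \<theta> powr \<sigma> \<le> M * (e / (M + 1))"
    using assms u by (intro mult_left_mono) auto
  also have "\<dots> \<le> e" using assms by (simp add: field_simps)
  finally show ?thesis using u by (intro exI[of _ \<theta>]) (auto simp: \<theta>_def)
qed

text \<open>Suppose \<open>m < s < m + 1\<close>. Down to a scale \<delta>, the coefficient of
  degree \<open>d\<close> is at most \<open>M * r powr (s - d)\<close>. Taking \<open>r\<close> =
  \<delta> makes the degrees up to \<open>m\<close> negligible, and \<open>r = 1\<close> bounds the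
  higher ones, which are small against \<open>\<theta> powr s\<close> at a small \<theta>. The
  polynomial then falls below its lower bound. The degree bound \<open>D\<close> is fixed while the
  coefficients may vary with \<open>e\<close>.\<close>

lemma nat_exponent_if_polynomial_growth:
  fixes s c K :: real
  assumes s: "s > 0" and c: "c > 0" and K: "K \<ge> 0"
    and growth: "\<And>e. e > 0 \<Longrightarrow> \<exists>b. \<forall>\<theta>. 0 \<le> \<theta> \<and> \<theta> \<le> 1 \<longrightarrow>
      c * \<theta> powr s - e \<le> (\<Sum>d\<le>D. \<theta> ^ d * b d) \<and> (\<Sum>d\<le>D. \<theta> ^ d * b d) \<le> K * \<theta> powr s + e"
  shows "\<exists>n::nat. s = real n"
proof (rule ccontr)
  assume nonat: "\<nexists>n::nat. s = real n"
  define M where "M = coefficient_bound D * (K + 1)"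
  define m where "m = nat \<lfloor>s\<rfloor>"
  have m: "real m < s" "s < real m + 1"
  proof -
    have "real m \<le> s" "s < real m + 1" unfolding m_def using s by linarith+
    moreover have "real m \<noteq> s" using nonat by auto
    ultimately show "real m < s" "s < real m + 1" by auto
  qed
  have M: "M \<ge> 0" using coefficient_bound_ge_1[of D] K by (simp add: M_def)
  \<comment> \<open>Order of choice: \<theta> disposes of the degrees above \<open>m\<close>; then
    \<delta>, depending on \<theta>, of the degrees up to \<open>m\<close>; finally \<open>e\<close>
    is small against both.\<close>
  obtain \<theta> where \<theta>: "0 < \<theta>" "\<theta> < 1" "M * \<theta> powr (real m + 1 - s) \<le> c / (4 * (D + 1))"
    using small_powr[of "real m + 1 - s" "c / (4 * (D + 1))" M] m M c by auto
  obtain \<delta> where \<delta>: "0 < \<delta>" "\<delta> < 1" "M * \<delta> powr (s - real m) \<le> c * \<theta> powr s / (4 * (D + 1))"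
    using small_powr[of "s - real m" "c * \<theta> powr s / (4 * (D + 1))" M] m M c \<theta> by auto
  define e where "e = min (\<delta> powr s) (c * \<theta> powr s / 2)"
  have e: "e > 0" "e \<le> \<delta> powr s" "e \<le> c * \<theta> powr s / 2" using \<delta> \<theta> c by (auto simp: e_def)
  from growth[OF e(1)] obtain b where "\<forall>\<theta>. 0 \<le> \<theta> \<and> \<theta> \<le> 1 \<longrightarrow>
      c * \<theta> powr s - e \<le> (\<Sum>d\<le>D. \<theta> ^ d * b d) \<and> (\<Sum>d\<le>D. \<theta> ^ d * b d) \<le> K * \<theta> powr s + e" ..
  then have low: "\<And>u. 0 \<le> u \<Longrightarrow> u \<le> 1 \<Longrightarrow> c * u powr s - e \<le> (\<Sum>d\<le>D. u ^ d * b d)"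
    and up: "\<And>u. 0 \<le> u \<Longrightarrow> u \<le> 1 \<Longrightarrow> (\<Sum>d\<le>D. u ^ d * b d) \<le> K * u powr s + e"
    by auto
  have coeff: "\<bar>b d\<bar> * r ^ d \<le> M * r powr s" if r: "\<delta> \<le> r" "r \<le> 1" and d: "d \<le> D" for r d
  proof -
    \<comment> \<open>The coefficient bound is applied to the polynomial rescaled from
      \<open>[0, r]\<close> to the unit interval.\<close>
    have "\<bar>r ^ d * b d\<bar> \<le> coefficient_bound D * ((K + 1) * r powr s)"
    proof (rule coefficient_bounded[OF d])
      fix t :: real assume t: "0 \<le> t" "t \<le> 1"
      have tr: "0 \<le> t * r" "t * r \<le> 1" "t * r \<le> r"
        using t r \<delta> by (auto simp: mult_le_one mult_left_le_one_le)
      have "(t * r) powr s \<le> r powr s" using tr s by (intro powr_mono2) auto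
      moreover have "e \<le> r powr s" using e(2) r \<delta> s powr_mono2[of s \<delta> r] by simp
      moreover have "0 \<le> c * (t * r) powr s" using c by simp
      moreover have "K * (t * r) powr s \<le> K * r powr s" using K calculation(1) by (intro mult_left_mono) auto
      moreover have "0 \<le> K * r powr s" using K by simp
      moreover have "(\<Sum>d\<le>D. t ^ d * (r ^ d * b d)) = (\<Sum>d\<le>D. (t * r) ^ d * b d)"
        by (simp add: power_mult_distrib mult_ac)
      moreover have "(K + 1) * r powr s = K * r powr s + r powr s" by (simp add: algebra_simps)
      ultimately show "\<bar>\<Sum>d\<le>D. t ^ d * (r ^ d * b d)\<bar> \<le> (K + 1) * r powr s"
        using low[OF tr(1,2)] up[OF tr(1,2)] by linarith
    qed
    then show ?thesis using r \<delta> by (simp add: M_def abs_mult mult_ac)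
  qed
  have term_le: "\<theta> ^ d * b d \<le> c * \<theta> powr s / (4 * (D + 1))" if d: "d \<le> D" for d
  proof -
    have "\<theta> ^ d * b d \<le> \<theta> ^ d * \<bar>b d\<bar>" using \<theta> by (intro mult_left_mono) auto
    also have "\<dots> \<le> c * \<theta> powr s / (4 * (D + 1))"
    proof (cases "d \<le> m")
      case True
      have "\<bar>b d\<bar> \<le> M * \<delta> powr s / \<delta> ^ d"
        using coeff[of \<delta> d] \<delta> d by (simp add: field_simps)
      also have "\<dots> = M * \<delta> powr (s - real d)"
        using \<delta> by (simp add: powr_diff powr_realpow)
      also have "\<dots> \<le> M * \<delta> powr (s - real m)"
        using \<delta> M True by (intro mult_left_mono powr_mono') auto
      also note \<delta>(3)
      finally have "\<bar>b d\<bar> \<le> c * \<theta> powr s / (4 * (D + 1))" .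
      moreover have "\<theta> ^ d * \<bar>b d\<bar> \<le> \<bar>b d\<bar>"
        using \<theta> by (simp add: mult_left_le_one_le power_le_one)
      ultimately show ?thesis by linarith
    next
      case False
      have "\<theta> ^ d * \<bar>b d\<bar> \<le> \<theta> powr (real m + 1) * M"
      proof (intro mult_mono)
        show "\<theta> ^ d \<le> \<theta> powr (real m + 1)"
          using \<theta> False powr_mono'[of "real m + 1" "real d" \<theta>] by (simp add: powr_realpow)
        show "\<bar>b d\<bar> \<le> M" using coeff[of 1 d] \<delta> d by simp
      qed (use M in auto)
      also have "\<dots> = \<theta> powr s * (M * \<theta> powr (real m + 1 - s))"
        using \<theta> by (simp add: powr_diff)
      also have "\<dots> \<le> \<theta> powr s * (c / (4 * (D + 1)))"
        using \<theta> by (intro mult_left_mono) auto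
      finally show ?thesis by (simp add: mult.commute)
    qed
    finally show ?thesis .
  qed
  have "(\<Sum>d\<le>D. \<theta> ^ d * b d) \<le> (\<Sum>d\<le>D. c * \<theta> powr s / (4 * (D + 1)))"
    using term_le by (intro sum_mono) auto
  also have "\<dots> = c * \<theta> powr s / 4" by (simp add: field_simps)
  finally have "c * \<theta> powr s - e \<le> c * \<theta> powr s / 4"
    using low[of \<theta>] \<theta> by simp
  moreover have "0 < c * \<theta> powr s" using c \<theta> by simp
  ultimately show False using e(3) by linarith
qed

section \<open>Preparations for the minimisation argument\<close>

lemma lp_lq_subspace:
  assumes "p > 1" "q > 1"
  shows "linear_subspace (lp_lq_space p q)"
  using assms lp_lq_space_add lp_lq_space_scale lp_lq_space_zero
  by (auto simp: linear_subspace_def lincomb_def)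

lemma lp_lq_norm_lincomb:
  assumes "p > 1" "q > 1" "x \<in> lp_lq_space p q" "y \<in> lp_lq_space p q"
  shows "lp_lq_norm p q (lincomb a x b y) \<le> \<bar>a\<bar> * lp_lq_norm p q x + \<bar>b\<bar> * lp_lq_norm p q y"
  using lp_lq_norm_add[OF assms(1,2) lp_lq_space_scale[OF assms(1,2,3), of a]
      lp_lq_space_scale[OF assms(1,2,4), of b]]
    lp_lq_norm_scale[OF assms(1,2,3)] lp_lq_norm_scale[OF assms(1,2,4)]
  by (simp add: lincomb_def)

text \<open>After division by \<open>m\<close> every exponent \<open>k / r - 1\<close> is negative.
  This shows that the exceptional components are fewer than all components.\<close>

lemma eventually_sublinear:
  fixes c :: "nat \<Rightarrow> real" and r c0 :: real
  assumes "finite F" "\<And>k. k \<in> F \<Longrightarrow> real k < r" "r > 0"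
  shows "\<exists>M. \<forall>m\<ge>M. c0 + (\<Sum>k\<in>F. c k * real m powr (real k / r)) < real m"
proof -
  have "((\<lambda>m. c0 * (1 / real m) + (\<Sum>k\<in>F. c k * real m powr (real k / r - 1)))
      \<longlongrightarrow> c0 * 0 + (\<Sum>k\<in>F. c k * 0)) sequentially"
    using assms
    by (intro tendsto_add tendsto_mult tendsto_const tendsto_sum lim_1_over_n
        tendsto_neg_powr filterlim_real_sequentially) auto
  then have "eventually (\<lambda>m. c0 * (1 / real m) + (\<Sum>k\<in>F. c k * real m powr (real k / r - 1)) < 1) sequentially"
    by (intro order_tendstoD(2)) auto
  then have "eventually (\<lambda>m. c0 + (\<Sum>k\<in>F. c k * real m powr (real k / r)) < real m) sequentially"
    using eventually_gt_at_top[of "0::nat"]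
  proof eventually_elim
    case (elim m)
    have "c0 + (\<Sum>k\<in>F. c k * real m powr (real k / r))
        = real m * (c0 * (1 / real m) + (\<Sum>k\<in>F. c k * real m powr (real k / r - 1)))"
      using elim(2) by (simp add: distrib_left sum_distrib_left powr_diff)
    also have "\<dots> < real m * 1"
      using elim by (intro mult_strict_left_mono) auto
    finally show ?case by simp
  qed
  then show ?thesis by (simp add: eventually_sequentially)
qed

text \<open>The right-hand side tends to \<open>t powr r\<close> as \<gamma> decreases to 0. It
  bounds from below the growth of the norm power when a step \<open>t\<close> is made in a component
  where the base point has size at most \<gamma>.\<close>

lemma powr_perturbation:
  fixes r t e :: real
  assumes "r > 0" "t > 0" "e > 0"
  shows "\<exists>\<gamma>>0. \<gamma> < t \<and> t powr r - e \<le> (t - \<gamma>) powr r - \<gamma> powr r"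
proof -
  have "((\<lambda>\<gamma>. (t - \<gamma>) powr r - \<gamma> powr r) \<longlongrightarrow> (t - 0) powr r - 0 powr r) (at_right 0)"
    using assms by (intro tendsto_diff tendsto_powr' tendsto_const tendsto_ident_at)
      (auto simp: eventually_at_filter)
  then have "eventually (\<lambda>\<gamma>. t powr r - e < (t - \<gamma>) powr r - \<gamma> powr r) (at_right 0)"
    using assms by (intro order_tendstoD(1)) auto
  moreover have "eventually (\<lambda>\<gamma>. \<gamma> \<in> {0<..<t}) (at_right 0)"
    using assms by (intro eventually_at_right_real)
  ultimately have "eventually (\<lambda>\<gamma>. t powr r - e < (t - \<gamma>) powr r - \<gamma> powr r \<and> \<gamma> \<in> {0<..<t}) (at_right 0)"
    by eventually_elim simp
  from eventually_happens[OF this] show ?thesis by (auto intro: less_imp_le)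
qed

text \<open>Common to the blocks of the whole space (\<open>r = p\<close>) and to the coordinates of a single
  block (\<open>r = q\<close>): \<open>E j\<close> holds the vectors living in component \<open>j\<close>, and \<open>g j z\<close> is the
  size of component \<open>j\<close> of \<open>z\<close>.\<close>

definition block_family ::
  "real \<Rightarrow> real \<Rightarrow> real \<Rightarrow> blockseq set \<Rightarrow> nat set \<Rightarrow> (nat \<Rightarrow> blockseq set)
     \<Rightarrow> (nat \<Rightarrow> blockseq \<Rightarrow> real) \<Rightarrow> bool" where
  "block_family p q r Z J E g \<longleftrightarrow>
     linear_subspace Z \<and> Z \<subseteq> lp_lq_space p q \<and> finite J \<and>
     (\<forall>j\<in>J. E j \<subseteq> Z) \<and>
     (\<forall>z\<in>Z. \<forall>j\<in>J. 0 \<le> g j z) \<and>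
     (\<forall>z\<in>Z. \<forall>j\<in>J. \<forall>h\<in>E j. \<forall>s. lp_lq_norm p q h = 1 \<and> g j z \<le> \<bar>s\<bar> \<longrightarrow>
        lp_lq_norm p q z powr r - g j z powr r + (\<bar>s\<bar> - g j z) powr r
          \<le> lp_lq_norm p q (lincomb 1 z s h) powr r) \<and>
     (\<forall>z\<in>Z. (\<Sum>j\<in>J. g j z powr r) \<le> lp_lq_norm p q z powr r) \<and>
     (\<forall>h B. B \<subseteq> J \<and> (\<forall>j\<in>B. h j \<in> E j \<and> lp_lq_norm p q (h j) = 1) \<longrightarrow>
        lp_lq_norm p q (set_sum h B) \<le> real (card B) powr (1 / r))"

section \<open>A separating polynomial and its Taylor coefficients on the unit ball\<close>

locale separating =
  fixes p q :: real and N :: nat and P :: "blockseq \<Rightarrow> real"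
  assumes p: "p > 1" and q: "q > 1"
    and poly: "polynomial_le (lp_lq_space p q) N P"
    and sep: "separating_polynomial p q P"
begin

abbreviation "X \<equiv> lp_lq_space p q"
abbreviation "nrm \<equiv> lp_lq_norm p q"
abbreviation "T \<equiv> taylor_coeff N P"
abbreviation "zero \<equiv> (\<lambda>(n::nat) (i::nat). 0::real)"

lemmas subspace = lp_lq_subspace[OF p q]
lemmas nrm_lincomb = lp_lq_norm_lincomb[OF p q]
lemmas nrm_scale = lp_lq_norm_scale[OF p q]
lemmas scale_in = lp_lq_space_scale[OF p q]

lemma zero_in: "zero \<in> X" and nrm_zero: "nrm zero = 0"
  using p q by (auto simp: lp_lq_space_zero lp_lq_norm_zero)

lemma lincomb_in: "x \<in> X \<Longrightarrow> y \<in> X \<Longrightarrow> lincomb a x b y \<in> X"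
  using subspace by (simp add: linear_subspace_def)

lemma P_zero: "P zero = 0" and P_sphere: "x \<in> X \<Longrightarrow> nrm x = 1 \<Longrightarrow> P x \<ge> 1"
  using sep by (auto simp: separating_polynomial_def)

lemmas T_expansion = taylor_expansion[OF poly subspace]
lemmas T_scale = taylor_coeff_scale[OF poly subspace]

lemma lincomb_zero_left: "lincomb 1 zero t x = (\<lambda>n i. t * x n i)"
  by (simp add: lincomb_def)

text \<open>Continuity at 0 bounds \<open>P\<close> on a small ball, interpolation passes the bound
  to the coefficients there, and homogeneity extends it to the unit ball.\<close>

lemma T_bounded_at_zero:
  "\<exists>C\<ge>0. \<forall>x\<in>X. nrm x \<le> 1 \<longrightarrow> (\<forall>k\<le>N. \<bar>T k zero x\<bar> \<le> C)"
proof -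
  have "\<exists>d>0. \<forall>y\<in>X. nrm (lincomb 1 y (-1) zero) < d \<longrightarrow> \<bar>P y - P zero\<bar> < 1"
    using sep zero_in unfolding separating_polynomial_def by (meson zero_less_one)
  then obtain d where d: "d > 0" and dP: "\<And>y. y \<in> X \<Longrightarrow> nrm y < d \<Longrightarrow> \<bar>P y\<bar> < 1"
    by (auto simp: lincomb_def P_zero)
  \<comment> \<open>The cap at 1 gives \<open>e ^ N \<le> e ^ k\<close>, so that one constant serves
    all orders.\<close>
  define e where "e = min 1 (d / 2)"
  have e: "0 < e" "e < d" "e \<le> 1" using d by (auto simp: e_def)
  have "\<bar>T k zero x\<bar> \<le> coefficient_bound N / e ^ N" if x: "x \<in> X" "nrm x \<le> 1" and k: "k \<le> N" for x k
  proof -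
    have "\<bar>T k zero (\<lambda>n i. e * x n i)\<bar> \<le> coefficient_bound N * 1"
      unfolding taylor_coeff_def
    proof (rule weighted_sum_bound[OF k])
      fix l
      have "nrm (\<lambda>n i. ((1/2)^l * e) * x n i) = (1/2)^l * e * nrm x"
        using nrm_scale[OF x(1), of "(1/2)^l * e"] e by (simp add: abs_mult)
      also have "\<dots> \<le> 1 * e * 1"
        using e x by (intro mult_mono) (auto simp: power_le_one)
      finally have "nrm (\<lambda>n i. ((1/2)^l * e) * x n i) < d" using e by simp
      with scale_in[OF x(1)] have "\<bar>P (\<lambda>n i. ((1/2)^l * e) * x n i)\<bar> < 1" by (rule dP)
      then show "\<bar>P (lincomb 1 zero ((1/2)^l) (\<lambda>n i. e * x n i))\<bar> \<le> 1"
        by (simp add: lincomb_def mult.assoc)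
    qed
    then have "e ^ k * \<bar>T k zero x\<bar> \<le> coefficient_bound N"
      using T_scale[OF x(1) zero_in k, of e] e by (simp add: abs_mult)
    moreover have "e ^ N * \<bar>T k zero x\<bar> \<le> e ^ k * \<bar>T k zero x\<bar>"
      using e k by (intro mult_right_mono power_decreasing) auto
    ultimately show ?thesis using e by (simp add: field_simps)
  qed
  moreover have "0 \<le> coefficient_bound N / e ^ N"
    using coefficient_bound_ge_1[of N] e by simp
  ultimately show ?thesis by blast
qed

text \<open>Along a ray \<open>P\<close> is a polynomial with bounded coefficients, so it is bounded
  on the ball and varies in a uniformly Lipschitz way near the sphere, where it is at least
  1.\<close>

lemma P_on_ball:
  "\<exists>C \<delta>. 0 \<le> C \<and> 0 < \<delta> \<and> \<delta> < 1 \<and> (\<forall>x\<in>X. nrm x \<le> 1 \<longrightarrow> \<bar>P x\<bar> \<le> C)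
     \<and> (\<forall>x\<in>X. 1 - \<delta> < nrm x \<and> nrm x \<le> 1 \<longrightarrow> 3/4 \<le> P x)"
proof -
  from T_bounded_at_zero obtain C where C: "C \<ge> 0"
    and TC: "\<And>x k. x \<in> X \<Longrightarrow> nrm x \<le> 1 \<Longrightarrow> k \<le> N \<Longrightarrow> \<bar>T k zero x\<bar> \<le> C"
    by blast
  have P_eq: "P (\<lambda>n i. t * x n i) = (\<Sum>k\<le>N. t ^ k * T k zero x)" if "x \<in> X" for x t
    using T_expansion[OF that zero_in, of t] by (simp add: lincomb_zero_left)
  have bound: "\<bar>P x\<bar> \<le> (N + 1) * C" if x: "x \<in> X" "nrm x \<le> 1" for x
  proof -
    have "\<bar>P x\<bar> = \<bar>\<Sum>k\<le>N. T k zero x\<bar>" using P_eq[OF x(1), of 1] by simp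
    also have "\<dots> \<le> (\<Sum>k\<le>N. \<bar>T k zero x\<bar>)" by (rule sum_abs)
    also have "\<dots> \<le> (\<Sum>k\<le>N. C)" using TC x by (intro sum_mono) auto
    finally show ?thesis by (simp add: add.commute)
  qed
  \<comment> \<open>By Bernoulli's inequality \<open>1 - s ^ k \<le> N * (1 - s)\<close>, so moving
    inwards from the sphere to radius \<open>s\<close> lowers \<open>P\<close> by at most
    \<open>(1 - s) * D\<close>; \<delta> keeps this loss below 1/4.\<close>
  define D where "D = (N + 1) * (N * C)"
  define \<delta> where "\<delta> = 1 / (4 * (D + 1))"
  have D: "D \<ge> 0" using C by (simp add: D_def)
  have \<delta>: "0 < \<delta>" "\<delta> < 1" "\<delta> * D \<le> 1/4"
    using D by (auto simp: \<delta>_def field_simps)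
  have "3/4 \<le> P x" if x: "x \<in> X" "1 - \<delta> < nrm x" "nrm x \<le> 1" for x
  proof -
    define s where "s = nrm x"
    define y where "y = (\<lambda>n i. (1/s) * x n i)"
    have s: "0 < s" "1 - s < \<delta>" "s \<le> 1" using x \<delta> by (auto simp: s_def)
    have y: "y \<in> X" "nrm y = 1"
      using scale_in[OF x(1), of "1/s"] nrm_scale[OF x(1), of "1/s"] s
      by (auto simp: y_def simp flip: s_def)
    have xy: "x = (\<lambda>n i. s * y n i)" using s by (simp add: y_def)
    have "P y - P x = (\<Sum>k\<le>N. (1 - s ^ k) * T k zero y)"
      using P_eq[OF y(1), of 1] P_eq[OF y(1), of s]
      by (subst xy) (simp add: sum_subtractf left_diff_distrib)
    also have "\<dots> \<le> (\<Sum>k\<le>N. (N * (1 - s)) * C)"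
    proof (intro sum_mono)
      fix k assume k: "k \<in> {..N}"
      have "1 + real k * (s - 1) \<le> (1 + (s - 1)) ^ k"
        using s by (intro Bernoulli_inequality) auto
      then have "1 - s ^ k \<le> k * (1 - s)" by (simp add: algebra_simps)
      also have "\<dots> \<le> N * (1 - s)" using k s by (intro mult_right_mono) auto
      finally have "1 - s ^ k \<le> N * (1 - s)" .
      moreover have "T k zero y \<le> C" "0 \<le> 1 - s ^ k"
        using TC[of y k] y k s by (auto simp: power_le_one)
      ultimately show "(1 - s ^ k) * T k zero y \<le> (N * (1 - s)) * C"
        using C s by (meson mult_left_mono mult_right_mono order_trans)
    qed
    also have "\<dots> = (1 - s) * D" by (simp add: D_def algebra_simps)
    also have "\<dots> \<le> \<delta> * D" using s D by (intro mult_right_mono) auto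
    finally show ?thesis using P_sphere[OF y] \<delta>(3) by linarith
  qed
  then show ?thesis using \<delta> bound C by (intro exI[of _ "(N + 1) * C"] exI[of _ \<delta>]) auto
qed

text \<open>A Cauchy estimate: all interpolation nodes in a direction of norm at most \<delta> stay
  in the unit ball, and homogeneity rescales to norm \<open>R\<close>.\<close>

lemma T_bound:
  assumes C: "\<And>x. x \<in> X \<Longrightarrow> nrm x \<le> 1 \<Longrightarrow> \<bar>P x\<bar> \<le> C" and \<delta>: "0 < \<delta>" "\<delta> < 1"
    and x: "x \<in> X" "nrm x \<le> 1 - \<delta>" and h: "h \<in> X" "nrm h \<le> R" and R: "R > 0" and k: "k \<le> N"
  shows "\<bar>T k x h\<bar> \<le> coefficient_bound N * C * (R / \<delta>) ^ k"
proof -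
  define y where "y = (\<lambda>n i. (\<delta> / R) * h n i)"
  have "nrm y = \<delta> / R * nrm h"
    using nrm_scale[OF h(1), of "\<delta> / R"] R \<delta> by (simp add: y_def)
  also have "\<dots> \<le> \<delta> / R * R"
    using h R \<delta> by (intro mult_left_mono) auto
  finally have y: "y \<in> X" "nrm y \<le> \<delta>"
    using scale_in[OF h(1), of "\<delta> / R"] R by (auto simp: y_def)
  have "h = (\<lambda>n i. (R / \<delta>) * y n i)" using R \<delta> by (simp add: y_def)
  then have "T k x h = (R / \<delta>) ^ k * T k x y"
    using T_scale[OF y(1) x(1) k, of "R / \<delta>"] by simp
  moreover have "\<bar>T k x y\<bar> \<le> coefficient_bound N * C"
    unfolding taylor_coeff_def
  proof (rule weighted_sum_bound[OF k])
    fix l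
    have "nrm (lincomb 1 x ((1/2)^l) y) \<le> nrm x + (1/2)^l * nrm y"
      using nrm_lincomb[OF x(1) y(1), of 1 "(1/2)^l"] by simp
    also have "(1/2)^l * nrm y \<le> 1 * \<delta>"
      using y by (intro mult_mono) (auto simp: power_le_one)
    finally show "\<bar>P (lincomb 1 x ((1/2)^l) y)\<bar> \<le> C"
      using x by (intro C lincomb_in y(1)) auto
  qed
  then have "(R / \<delta>) ^ k * \<bar>T k x y\<bar> \<le> (R / \<delta>) ^ k * (coefficient_bound N * C)"
    using R \<delta> by (intro mult_left_mono) auto
  ultimately show ?thesis using R \<delta> by (simp add: abs_mult mult_ac)
qed

end

section \<open>Near-minimisers\<close>

context separating begin

text \<open>The infimum need not be attained, hence the slack \<open>e\<close>. Near the sphere the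
  function is at least 3/4 - 1/2 = 1/4, while a near-minimiser has value at most \<open>e\<close>,
  since the value at 0 is 0. Working in a subspace \<open>Z\<close> allows restriction to one
  block.\<close>

lemma near_minimiser:
  assumes C: "\<And>x. x \<in> X \<Longrightarrow> nrm x \<le> 1 \<Longrightarrow> \<bar>P x\<bar> \<le> C"
    and \<delta>: "0 < \<delta>" "\<delta> < 1"
    and rim: "\<And>x. x \<in> X \<Longrightarrow> 1 - \<delta> < nrm x \<Longrightarrow> nrm x \<le> 1 \<Longrightarrow> 3/4 \<le> P x"
    and r: "r > 0" and e: "0 < e" "e < 1/4" and Z: "linear_subspace Z" "Z \<subseteq> X"
  shows "\<exists>x\<in>Z. nrm x \<le> 1 - \<delta> \<and>
    (\<forall>z\<in>Z. nrm z \<le> 1 \<longrightarrow> P x - nrm x powr r / 2 \<le> P z - nrm z powr r / 2 + e)"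
proof -
  define f where "f = (\<lambda>z. P z - nrm z powr r / 2)"
  define V where "V = f ` {z\<in>Z. nrm z \<le> 1}"
  have zeroZ: "zero \<in> Z" using Z by (simp add: linear_subspace_def)
  have f0: "f zero = 0" by (simp add: f_def P_zero nrm_zero)
  have pow1: "nrm z powr r \<le> 1" if "nrm z \<le> 1" for z
    using that r powr_mono2[of r "nrm z" 1] by simp
  have "- C - 1/2 \<le> f z" if "z \<in> Z" "nrm z \<le> 1" for z
    using C[of z] pow1[of z] that Z unfolding f_def by (auto simp: abs_le_iff)
  then have bdd: "bdd_below V" by (auto simp: V_def intro!: bdd_belowI)
  have "V \<noteq> {}" using zeroZ by (auto simp: V_def nrm_zero intro!: exI[of _ zero])
  from cInf_lessD[OF this, of "Inf V + e"] e(1) obtain v where v: "v \<in> V" "v < Inf V + e" by auto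
  then obtain x where x: "x \<in> Z" "nrm x \<le> 1" "v = f x" by (auto simp: V_def)
  have min: "f x \<le> f z + e" if "z \<in> Z" "nrm z \<le> 1" for z
    using cInf_lower[OF _ bdd, of "f z"] that v(2) x by (auto simp: V_def)
  have "nrm x \<le> 1 - \<delta>"
  proof (rule ccontr)
    assume "\<not> nrm x \<le> 1 - \<delta>"
    then have "3/4 \<le> P x" using rim[of x] x Z by auto
    moreover have "f x \<le> e" using min[OF zeroZ] f0 by (simp add: nrm_zero)
    ultimately show False using pow1[OF x(2)] e unfolding f_def by linarith
  qed
  then show ?thesis using x min unfolding f_def by blast
qed

text \<open>Pick a violating unit vector in each exceptional component. Their partial sums have norm
  at most \<open>card J powr (1 / r)\<close>, so the Cauchy estimate and
  \<open>taylor_coeff_sum_abs\<close> bound the total of their coefficients. For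
  \<open>k < r\<close> the bound is sublinear in \<open>card J\<close>.\<close>

lemma low_order_coefficients_small:
  assumes C: "\<And>x. x \<in> X \<Longrightarrow> nrm x \<le> 1 \<Longrightarrow> \<bar>P x\<bar> \<le> C"
    and \<delta>: "0 < \<delta>" "\<delta> < 1" and r: "r > 0"
    and fam: "block_family p q r Z J E g" and x: "x \<in> Z" "nrm x \<le> 1 - \<delta>"
    and k: "1 \<le> k" "k \<le> N" and \<beta>: "\<beta> > 0"
  shows "\<beta> * real (card {j\<in>J. \<exists>h\<in>E j. nrm h = 1 \<and> \<beta> < \<bar>T k x h\<bar>})
     \<le> 2 * (coefficient_bound k * (coefficient_bound N * C / \<delta> ^ k)) * real (card J) powr (real k / r)"
proof -
  define J' where "J' = {j\<in>J. \<exists>h\<in>E j. nrm h = 1 \<and> \<beta> < \<bar>T k x h\<bar>}"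
  define R where "R = real (card J) powr (1 / r)"
  have "\<forall>j. \<exists>h. j \<in> J' \<longrightarrow> h \<in> E j \<and> nrm h = 1 \<and> \<beta> < \<bar>T k x h\<bar>"
    by (auto simp: J'_def)
  from choice[OF this] obtain h where
    h: "\<And>j. j \<in> J' \<Longrightarrow> h j \<in> E j" "\<And>j. j \<in> J' \<Longrightarrow> nrm (h j) = 1"
       "\<And>j. j \<in> J' \<Longrightarrow> \<beta> < \<bar>T k x (h j)\<bar>" by blast
  have J: "finite J" "J' \<subseteq> J" "Z \<subseteq> X" "\<And>j. j \<in> J \<Longrightarrow> E j \<subseteq> Z"
    using fam by (auto simp: block_family_def J'_def)
  have finJ': "finite J'" using J finite_subset by blast
  show ?thesis
  proof (cases "J' = {}")
    case True
    have "0 \<le> C" using C[OF zero_in] nrm_zero by simp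
    then show ?thesis unfolding J'_def[symmetric] True
      using coefficient_bound_ge_1[of k] coefficient_bound_ge_1[of N] \<delta> by simp
  next
    case False
    then have cardJ: "card J > 0" using J by (auto simp: card_gt_0_iff)
    then have R: "R > 0" by (simp add: R_def)
    have hX: "h j \<in> X" if "j \<in> J'" for j using h(1)[OF that] J that by blast
    have xX: "x \<in> X" using x J by blast
    have "\<beta> * card J' = (\<Sum>j\<in>J'. \<beta>)" by simp
    also have "\<dots> \<le> (\<Sum>j\<in>J'. \<bar>T k x (h j)\<bar>)" using h(3) by (intro sum_mono) (auto intro: less_imp_le)
    also have "\<dots> \<le> 2 * (coefficient_bound k * (coefficient_bound N * C * (R / \<delta>) ^ k))"
    proof (rule taylor_coeff_sum_abs[OF poly subspace finJ' hX xX k])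
      fix B assume B: "B \<subseteq> J'"
      have "B \<subseteq> J \<and> (\<forall>j\<in>B. h j \<in> E j \<and> nrm (h j) = 1)"
        using B J h by blast
      then have "nrm (set_sum h B) \<le> real (card B) powr (1 / r)"
        using fam unfolding block_family_def by blast
      also have "\<dots> \<le> R"
        unfolding R_def using r card_mono[of J B] B J by (intro powr_mono2) auto
      finally have "nrm (set_sum h B) \<le> R" .
      moreover have "set_sum h B \<in> X"
      proof -
        have "set_sum h B = (\<lambda>n i. \<Sum>j\<in>B. 1 * h j n i)" by (simp add: set_sum_def)
        also have "\<dots> \<in> X"
          by (rule lp_lq_space_sum[OF p q]) (use B finJ' finite_subset hX in auto)
        finally show ?thesis .
      qed
      ultimately show "\<bar>T k x (set_sum h B)\<bar> \<le> coefficient_bound N * C * (R / \<delta>) ^ k"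
        using T_bound[OF C \<delta> xX x(2)] R k by blast
    qed
    also have "(R / \<delta>) ^ k = real (card J) powr (real k / r) / \<delta> ^ k"
      using cardJ by (simp add: R_def power_divide powr_realpow[symmetric] powr_powr)
    finally show ?thesis by (simp add: J'_def)
  qed
qed

text \<open>\<open>M\<close> is independent of the family, and \<open>x\<close> and \<open>j\<close>
  are chosen before \<open>h\<close>: a single component works for all its unit vectors. That
  uniformity is what the comparison of \<open>p\<close> with \<open>q\<close> rests on.\<close>

definition high_order_large :: "real \<Rightarrow> real \<Rightarrow> real \<Rightarrow> real \<Rightarrow> nat \<Rightarrow> bool" where
  "high_order_large r t \<eta> K M \<longleftrightarrow> (\<forall>Z J E g. block_family p q r Z J E g \<and> M \<le> card J \<longrightarrow>
     (\<exists>x\<in>Z. \<exists>j\<in>J. \<forall>h\<in>E j. nrm h = 1 \<longrightarrow> (\<forall>k\<le>N. \<bar>T k x h\<bar> \<le> K) \<and>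
        t powr r / 2 - \<eta> \<le> (\<Sum>k\<in>{k. k \<le> N \<and> even k \<and> r \<le> real k}. t ^ k * T k x h)))"

lemma high_order_largeD:
  assumes "high_order_large r t \<eta> K M" "block_family p q r Z J E g" "M \<le> card J"
  shows "\<exists>x\<in>Z. \<exists>j\<in>J. \<forall>h\<in>E j. nrm h = 1 \<longrightarrow> (\<forall>k\<le>N. \<bar>T k x h\<bar> \<le> K) \<and>
     t powr r / 2 - \<eta> \<le> (\<Sum>k\<in>{k. k \<le> N \<and> even k \<and> r \<le> real k}. t ^ k * T k x h)"
  using assms(1)[unfolded high_order_large_def, THEN spec, THEN spec, THEN spec, THEN spec, THEN mp]
    assms(2,3) by iprover

text \<open>\<delta> and \<open>K\<close> depend on \<open>P\<close> alone, so \<open>t\<close> can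
  later be taken small relative to \<open>K\<close>. A component is exceptional if the
  near-minimiser is large there or if some low-order coefficient is; for large \<open>card J\<close>
  an unexceptional one exists, and the second difference of \<open>P\<close> is examined
  there.\<close>

lemma high_order_coefficients_large:
  "\<exists>\<delta> K. 0 < \<delta> \<and> \<delta> < 1 \<and> 0 \<le> K \<and>
     (\<forall>r>0. \<forall>t \<eta>. 0 < t \<and> t < \<delta> \<and> 0 < \<eta> \<longrightarrow> (\<exists>M. high_order_large r t \<eta> K M))"
proof -
  obtain C \<delta> where C0: "0 \<le> C" and \<delta>: "0 < \<delta>" "\<delta> < 1"
    and C: "\<And>x. x \<in> X \<Longrightarrow> nrm x \<le> 1 \<Longrightarrow> \<bar>P x\<bar> \<le> C"
    and rim: "\<And>x. x \<in> X \<Longrightarrow> 1 - \<delta> < nrm x \<Longrightarrow> nrm x \<le> 1 \<Longrightarrow> 3/4 \<le> P x"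
    using P_on_ball by blast
  define K where "K = coefficient_bound N * C / \<delta> ^ N"
  have W: "0 \<le> coefficient_bound N * C" using C0 coefficient_bound_ge_1[of N] by simp
  have K: "K \<ge> 0" using W \<delta> by (simp add: K_def)
  have main: "\<exists>M. high_order_large r t \<eta> K M"
    if r: "r > 0" and t: "0 < t" "t < \<delta>" and \<eta>: "0 < \<eta>" for r t \<eta>
  proof -
    \<comment> \<open>The error \<eta> is shared out: a quarter each to the near-minimality, to the
      loss through \<gamma> and to the low orders. The cap 1/8 meets the requirement of
      \<open>near_minimiser\<close>.\<close>
    define e where "e = min (1/8) (\<eta> / 4)"
    have e: "0 < e" "e < 1/4" "e \<le> \<eta> / 4" using \<eta> by (auto simp: e_def)
    obtain \<gamma> where \<gamma>: "0 < \<gamma>" "\<gamma> < t" "t powr r - \<eta> / 2 \<le> (t - \<gamma>) powr r - \<gamma> powr r"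
      using powr_perturbation[OF r t(1), of "\<eta> / 2"] \<eta> by auto
    define \<beta> where "\<beta> = \<eta> / (4 * (N + 1))"
    have \<beta>: "\<beta> > 0" using \<eta> by (simp add: \<beta>_def)
    define F where "F = {k. 1 \<le> k \<and> k \<le> N \<and> real k < r}"
    have finF: "finite F" by (rule finite_subset[of _ "{..N}"]) (auto simp: F_def)
    define c where "c = (\<lambda>k. 2 * (coefficient_bound k * (coefficient_bound N * C / \<delta> ^ k)) / \<beta>)"
    obtain M where M: "\<And>m. M \<le> m \<Longrightarrow> 1 / \<gamma> powr r + (\<Sum>k\<in>F. c k * real m powr (real k / r)) < real m"
      using eventually_sublinear[OF finF _ r, of "1 / \<gamma> powr r" c] by (auto simp: F_def)
    have "high_order_large r t \<eta> K M"
      unfolding high_order_large_def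
    proof (intro allI impI)
      fix Z J E g assume asm: "block_family p q r Z J E g \<and> M \<le> card J"
      then have fam: "block_family p q r Z J E g" and card: "M \<le> card J" by auto
      have Z: "linear_subspace Z" "Z \<subseteq> X" and J: "finite J" and EZ: "\<And>j. j \<in> J \<Longrightarrow> E j \<subseteq> Z"
        and g0: "\<And>z j. z \<in> Z \<Longrightarrow> j \<in> J \<Longrightarrow> 0 \<le> g j z"
        and gsum: "\<And>z. z \<in> Z \<Longrightarrow> (\<Sum>j\<in>J. g j z powr r) \<le> nrm z powr r"
        using fam by (auto simp: block_family_def)
      have step: "nrm z powr r - g j z powr r + (\<bar>s\<bar> - g j z) powr r \<le> nrm (lincomb 1 z s h) powr r"
        if "z \<in> Z" "j \<in> J" "h \<in> E j" "nrm h = 1" "g j z \<le> \<bar>s\<bar>" for z j h s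
        using fam that unfolding block_family_def by blast
      obtain x where x: "x \<in> Z" "nrm x \<le> 1 - \<delta>"
        and min: "\<And>z. z \<in> Z \<Longrightarrow> nrm z \<le> 1 \<Longrightarrow> P x - nrm x powr r / 2 \<le> P z - nrm z powr r / 2 + e"
        using near_minimiser[OF C \<delta> rim r e(1,2) Z] by blast
      have xX: "x \<in> X" using x Z by blast
      \<comment> \<open>As the sizes of the components of \<open>x\<close> have \<open>r\<close>-th
        powers summing to at most 1, there are at most \<open>1 / \<gamma> powr r\<close> such
        indices.\<close>
      define J0 where "J0 = {j\<in>J. \<gamma> < g j x}"
      define B where "B = (\<lambda>k. {j\<in>J. \<exists>h\<in>E j. nrm h = 1 \<and> \<beta> < \<bar>T k x h\<bar>})"
      have "card J0 * \<gamma> powr r = (\<Sum>j\<in>J0. \<gamma> powr r)" by simp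
      also have "\<dots> \<le> (\<Sum>j\<in>J0. g j x powr r)"
        using \<gamma> r by (intro sum_mono powr_mono2) (auto simp: J0_def)
      also have "\<dots> \<le> (\<Sum>j\<in>J. g j x powr r)"
        using J by (intro sum_mono2) (auto simp: J0_def)
      also have "\<dots> \<le> nrm x powr r" using gsum x by simp
      also have "\<dots> \<le> 1" using x \<delta> r powr_mono2[of r "nrm x" 1] by simp
      finally have J0: "real (card J0) \<le> 1 / \<gamma> powr r" using \<gamma> by (simp add: field_simps)
      have Bk: "real (card (B k)) \<le> c k * real (card J) powr (real k / r)" if "k \<in> F" for k
      proof -
        have "\<beta> * real (card (B k)) \<le> 2 * (coefficient_bound k * (coefficient_bound N * C / \<delta> ^ k))
            * real (card J) powr (real k / r)"
          using low_order_coefficients_small[OF C \<delta> r fam x _ _ \<beta>, of k] that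
          by (simp add: B_def F_def)
        also have "\<dots> = \<beta> * (c k * real (card J) powr (real k / r))"
          using \<beta> by (simp add: c_def)
        finally show ?thesis using \<beta> by (simp only: mult_le_cancel_left_pos)
      qed
      have "card (J0 \<union> (\<Union>k\<in>F. B k)) \<le> card J0 + (\<Sum>k\<in>F. card (B k))"
        using card_Un_le[of J0 "\<Union>k\<in>F. B k"] card_UN_le[OF finF, of B] by linarith
      then have "real (card (J0 \<union> (\<Union>k\<in>F. B k))) \<le> real (card J0) + (\<Sum>k\<in>F. real (card (B k)))"
        by (metis of_nat_add of_nat_le_iff of_nat_sum)
      also have "\<dots> \<le> 1 / \<gamma> powr r + (\<Sum>k\<in>F. c k * real (card J) powr (real k / r))"
        using J0 Bk by (intro add_mono sum_mono) auto
      also have "\<dots> < real (card J)" by (rule M[OF card])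
      finally have "card (J0 \<union> (\<Union>k\<in>F. B k)) < card J" by simp
      then have "\<not> J \<subseteq> J0 \<union> (\<Union>k\<in>F. B k)"
        using card_mono[of "J0 \<union> (\<Union>k\<in>F. B k)" J] J finF by (auto simp: J0_def B_def)
      then obtain j where j: "j \<in> J" "j \<notin> J0" "\<And>k. k \<in> F \<Longrightarrow> j \<notin> B k" by blast
      have gj: "0 \<le> g j x" "g j x \<le> \<gamma>" using j g0[OF x(1) j(1)] by (auto simp: J0_def)
      have "(\<forall>k\<le>N. \<bar>T k x h\<bar> \<le> K) \<and>
          t powr r / 2 - \<eta> \<le> (\<Sum>k\<in>{k. k \<le> N \<and> even k \<and> r \<le> real k}. t ^ k * T k x h)"
        if h: "h \<in> E j" "nrm h = 1" for h
      proof
        have hZ: "h \<in> Z" using EZ j h by blast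
        have hX: "h \<in> X" using hZ Z by blast
        show "\<forall>k\<le>N. \<bar>T k x h\<bar> \<le> K"
        proof (intro allI impI)
          fix k assume k: "k \<le> N"
          have "\<bar>T k x h\<bar> \<le> coefficient_bound N * C * (1 / \<delta>) ^ k"
            using T_bound[OF C \<delta> xX x(2) hX _ _ k, of 1] h by simp
          also have "\<dots> \<le> coefficient_bound N * C * (1 / \<delta>) ^ N"
            using W \<delta> k by (intro mult_left_mono power_increasing) auto
          finally show "\<bar>T k x h\<bar> \<le> K" by (simp add: K_def power_divide)
        qed
        have near: "t powr r - \<eta> / 2 \<le> nrm (lincomb 1 x s h) powr r - nrm x powr r"
          "P x - nrm x powr r / 2 \<le> P (lincomb 1 x s h) - nrm (lincomb 1 x s h) powr r / 2 + e"
          if s: "\<bar>s\<bar> = t" for s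
        proof -
          have "(t - \<gamma>) powr r \<le> (t - g j x) powr r" "g j x powr r \<le> \<gamma> powr r"
            using gj \<gamma> r by (auto intro!: powr_mono2)
          moreover have "nrm x powr r - g j x powr r + (\<bar>s\<bar> - g j x) powr r
              \<le> nrm (lincomb 1 x s h) powr r"
            using step[OF x(1) j(1) h, of s] gj \<gamma> s by simp
          ultimately show "t powr r - \<eta> / 2 \<le> nrm (lincomb 1 x s h) powr r - nrm x powr r"
            using \<gamma>(3) s by simp
          \<comment> \<open>The step \<open>t\<close> is below \<delta> and \<open>x\<close> lies at
            depth \<delta> inside the ball, so the comparison point is admissible.\<close>
          have "nrm (lincomb 1 x s h) \<le> 1"
            using nrm_lincomb[OF xX hX, of 1 s] x t s h by simp
          moreover have "lincomb 1 x s h \<in> Z" using Z x hZ by (simp add: linear_subspace_def)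
          ultimately show "P x - nrm x powr r / 2
              \<le> P (lincomb 1 x s h) - nrm (lincomb 1 x s h) powr r / 2 + e"
            by (intro min)
        qed
        define G where "G = {k. k \<le> N \<and> even k \<and> 1 \<le> k}"
        \<comment> \<open>Adding the expansions at \<open>t\<close> and \<open>-t\<close> cancels
          the odd orders.\<close>
        have "P (lincomb 1 x t h) + P (lincomb 1 x (-t) h) = (\<Sum>k\<le>N. (t ^ k + (-t) ^ k) * T k x h)"
          using T_expansion[OF hX xX, of t] T_expansion[OF hX xX, of "-t"]
          by (simp add: sum.distrib distrib_right)
        also have "\<dots> = (t ^ 0 + (-t) ^ 0) * T 0 x h + (\<Sum>k\<in>{..N}-{0}. (t ^ k + (-t) ^ k) * T k x h)"
          by (intro sum.remove) auto
        also have "(\<Sum>k\<in>{..N}-{0}. (t ^ k + (-t) ^ k) * T k x h) = (\<Sum>k\<in>G. 2 * (t ^ k * T k x h))"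
        proof (rule sum.mono_neutral_cong_right)
          show "\<forall>k\<in>{..N} - {0} - G. (t ^ k + (-t) ^ k) * T k x h = 0"
          proof
            fix k assume "k \<in> {..N} - {0} - G"
            then have "odd k" by (auto simp: G_def)
            then show "(t ^ k + (-t) ^ k) * T k x h = 0" by simp
          qed
        qed (auto simp: G_def)
        also have "T 0 x h = P x"
        proof -
          have "lincomb 1 x 0 h = x" by (simp add: lincomb_def)
          moreover have "(\<Sum>k\<le>N. 0 ^ k * T k x h) = (\<Sum>k\<in>{0}. 0 ^ k * T k x h)"
            by (rule sum.mono_neutral_right) auto
          ultimately show ?thesis using T_expansion[OF hX xX, of 0] by simp
        qed
        finally have "P (lincomb 1 x t h) + P (lincomb 1 x (-t) h) = 2 * P x + 2 * (\<Sum>k\<in>G. t ^ k * T k x h)"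
          by (simp add: sum_distrib_left)
        \<comment> \<open>Near-minimality is used at both points \<open>x + t * h\<close> and
          \<open>x - t * h\<close>; each has norm power larger than that of \<open>x\<close> by at
          least \<open>t powr r - \<eta> / 2\<close>.\<close>
        then have G: "t powr r / 2 - \<eta> / 4 - e \<le> (\<Sum>k\<in>G. t ^ k * T k x h)"
          using near[of t] near[of "-t"] t by (simp add: field_simps)
        have finG: "finite G" by (rule finite_subset[of _ "{..N}"]) (auto simp: G_def)
        have "(\<Sum>k\<in>G \<inter> {k. real k < r}. t ^ k * T k x h) \<le> (\<Sum>k\<in>G \<inter> {k. real k < r}. \<beta>)"
        proof (intro sum_mono)
          fix k assume "k \<in> G \<inter> {k. real k < r}"
          then have "k \<in> F" by (auto simp: G_def F_def)
          from j(3)[OF this] h j(1) have "\<bar>T k x h\<bar> \<le> \<beta>" by (auto simp: B_def not_less)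
          moreover have "t ^ k * T k x h \<le> t ^ k * \<bar>T k x h\<bar>" using t by (intro mult_left_mono) auto
          moreover have "t ^ k * \<bar>T k x h\<bar> \<le> \<bar>T k x h\<bar>"
            using t \<delta> by (intro mult_left_le_one_le) (auto simp: power_le_one)
          ultimately show "t ^ k * T k x h \<le> \<beta>" by linarith
        qed
        also have "\<dots> \<le> real (N + 1) * \<beta>"
        proof -
          have "card (G \<inter> {k. real k < r}) \<le> card {..N}" by (intro card_mono) (auto simp: G_def)
          then show ?thesis using \<beta> by (simp add: mult_right_mono)
        qed
        also have "\<dots> = \<eta> / 4" by (simp add: \<beta>_def field_simps)
        finally have low: "(\<Sum>k\<in>G \<inter> {k. real k < r}. t ^ k * T k x h) \<le> \<eta> / 4" .
        have "(\<Sum>k\<in>G. t ^ k * T k x h)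
            = (\<Sum>k\<in>G \<inter> {k. real k < r}. t ^ k * T k x h) + (\<Sum>k\<in>G - {k. real k < r}. t ^ k * T k x h)"
          by (rule sum.Int_Diff[OF finG])
        also have "G - {k. real k < r} = {k. k \<le> N \<and> even k \<and> r \<le> real k}"
          using r by (auto simp: G_def)
        finally show "t powr r / 2 - \<eta> \<le> (\<Sum>k\<in>{k. k \<le> N \<and> even k \<and> r \<le> real k}. t ^ k * T k x h)"
          using G low e(3) \<eta> by linarith
      qed
      then show "\<exists>x\<in>Z. \<exists>j\<in>J. \<forall>h\<in>E j. nrm h = 1 \<longrightarrow> (\<forall>k\<le>N. \<bar>T k x h\<bar> \<le> K) \<and>
          t powr r / 2 - \<eta> \<le> (\<Sum>k\<in>{k. k \<le> N \<and> even k \<and> r \<le> real k}. t ^ k * T k x h)"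
        using x(1) j(1) by blast
    qed
    then show ?thesis ..
  qed
  then show ?thesis using \<delta> K by (intro exI[of _ \<delta>] exI[of _ K]) auto
qed

end

section \<open>Block families and evenness of the exponents\<close>

lemma powr_base_inj:
  fixes a b r :: real
  assumes "a powr r = b powr r" "r > 0" "a \<ge> 0" "b \<ge> 0"
  shows "a = b"
proof -
  have "a = (a powr r) powr (1 / r)" using assms(2-4) by (simp add: powr_powr)
  also have "\<dots> = (b powr r) powr (1 / r)" by (simp only: assms(1))
  also have "\<dots> = b" using assms(2-4) by (simp add: powr_powr)
  finally show ?thesis .
qed

text \<open>The \<open>p\<close>-th power of the norm is a sum over blocks, so the difference of the
  two series has a single nonzero term.\<close>

lemma lp_lq_norm_change_block:
  assumes p: "p > 1" and x: "x \<in> lp_lq_space p q" and y: "y \<in> lp_lq_space p q"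
    and eq: "\<And>n i. n \<noteq> j \<Longrightarrow> x n i = y n i"
  shows "lp_lq_norm p q x powr p - block_qnorm q x j powr p
       = lp_lq_norm p q y powr p - block_qnorm q y j powr p"
proof -
  let ?f = "\<lambda>n. block_qnorm q x n powr p" and ?g = "\<lambda>n. block_qnorm q y n powr p"
  have s: "summable ?f" "summable ?g" using x y by (auto simp: lp_lq_space_def)
  have "(\<lambda>n. ?f n - ?g n) = (\<lambda>n. if n = j then ?f j - ?g j else 0)"
    using eq by (auto simp: block_qnorm_def fun_eq_iff)
  then have "(\<Sum>n. ?f n - ?g n) = ?f j - ?g j"
    using sums_single[of j "\<lambda>_. ?f j - ?g j"] by (simp add: sums_iff)
  then show ?thesis
    using suminf_diff[OF s] by (simp add: lp_lq_norm_powr[OF p x] lp_lq_norm_powr[OF p y])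
qed

definition block_space :: "real \<Rightarrow> real \<Rightarrow> nat \<Rightarrow> blockseq set" where
  "block_space p q j = {x \<in> lp_lq_space p q. \<forall>n i. n \<noteq> j \<longrightarrow> x n i = 0}"

lemma lp_lq_norm_block_space:
  assumes p: "p > 1" and q: "q > 1" and x: "x \<in> block_space p q j"
  shows "lp_lq_norm p q x = block_qnorm q x j"
proof -
  have "lp_lq_norm p q x powr p = block_qnorm q x j powr p"
    using lp_lq_norm_change_block[of p x q "\<lambda>n i. 0" j] x p q
    by (simp add: block_space_def lp_lq_space_zero lp_lq_norm_zero block_qnorm_def)
  then show ?thesis by (rule powr_base_inj) (use p in simp_all)
qed

lemma block_space_subspace:
  assumes p: "p > 1" and q: "q > 1"
  shows "linear_subspace (block_space p q j)"
  using lp_lq_subspace[OF p q] by (auto simp: linear_subspace_def block_space_def lincomb_def)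

text \<open>A step in block \<open>j\<close> changes only the \<open>j\<close>-th summand of the
  norm power, and the reverse triangle inequality bounds that summand from below. Unit vectors from
  distinct blocks have disjoint supports, so their \<open>p\<close>-th powers add.\<close>

lemma block_family_blocks:
  assumes p: "p > 1" and q: "q > 1" and J: "finite J"
  shows "block_family p q p (lp_lq_space p q) J (block_space p q) (\<lambda>j z. block_qnorm q z j)"
  unfolding block_family_def
proof (intro conjI ballI allI impI)
  show "linear_subspace (lp_lq_space p q)" using lp_lq_subspace[OF p q] .
  show "block_space p q j \<subseteq> lp_lq_space p q" for j by (auto simp: block_space_def)
next
  fix z j h and s :: real
  assume z: "z \<in> lp_lq_space p q" and h: "h \<in> block_space p q j"
    and s: "lp_lq_norm p q h = 1 \<and> block_qnorm q z j \<le> \<bar>s\<bar>"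
  define w where "w = lincomb 1 z s h"
  have w: "w \<in> lp_lq_space p q"
    using z h lp_lq_subspace[OF p q] by (simp add: w_def linear_subspace_def block_space_def)
  \<comment> \<open>The reverse triangle inequality in block \<open>j\<close>, for
    \<open>s * h = w - z\<close>.\<close>
  have "block_qnorm q (\<lambda>n i. w n i + (-1) * z n i) j \<le> block_qnorm q w j + block_qnorm q z j"
    using block_qnorm_add[OF q, of w "\<lambda>n i. (-1) * z n i" j] block_qnorm_scale[OF q, of "-1" z j] by simp
  moreover have "(\<lambda>n i. w n i + (-1) * z n i) = (\<lambda>n i. s * h n i)"
    by (simp add: w_def lincomb_def)
  moreover have "block_qnorm q (\<lambda>n i. s * h n i) j = \<bar>s\<bar>"
    using s lp_lq_norm_block_space[OF p q h] by (simp add: block_qnorm_scale[OF q])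
  ultimately have "\<bar>s\<bar> - block_qnorm q z j \<le> block_qnorm q w j" by simp
  then have "(\<bar>s\<bar> - block_qnorm q z j) powr p \<le> block_qnorm q w j powr p"
    using s p by (intro powr_mono2) auto
  moreover have "lp_lq_norm p q w powr p - block_qnorm q w j powr p
      = lp_lq_norm p q z powr p - block_qnorm q z j powr p"
    using h by (intro lp_lq_norm_change_block[OF p w z]) (auto simp: w_def lincomb_def block_space_def)
  ultimately show "lp_lq_norm p q z powr p - block_qnorm q z j powr p + (\<bar>s\<bar> - block_qnorm q z j) powr p
      \<le> lp_lq_norm p q (lincomb 1 z s h) powr p"
    by (simp add: w_def)
next
  fix z assume z: "z \<in> lp_lq_space p q"
  then show "(\<Sum>j\<in>J. block_qnorm q z j powr p) \<le> lp_lq_norm p q z powr p"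
    unfolding lp_lq_norm_powr[OF p z] using J
    by (intro sum_le_suminf) (auto simp: lp_lq_space_def)
next
  fix h :: "nat \<Rightarrow> blockseq" and B
  assume B: "B \<subseteq> J \<and> (\<forall>j\<in>B. h j \<in> block_space p q j \<and> lp_lq_norm p q (h j) = 1)"
  have finB: "finite B" using B J finite_subset by blast
  have "set_sum h B n i = (if n \<in> B then h n n i else 0)" for n i
  proof -
    have "set_sum h B n i = (\<Sum>j\<in>B. if n = j then h j n i else 0)"
      unfolding set_sum_def using B by (intro sum.cong) (auto simp: block_space_def)
    then show ?thesis using finB by simp
  qed
  then have "block_qnorm q (set_sum h B) n powr p = (if n \<in> B then 1 else 0)" for n
    using B lp_lq_norm_block_space[OF p q, of "h n" n] by (auto simp: block_qnorm_def)
  then have "(\<Sum>n. block_qnorm q (set_sum h B) n powr p) = real (card B)"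
    using suminf_finite[OF finB, of "\<lambda>n. if n \<in> B then 1 else 0 :: real"] by simp
  then show "lp_lq_norm p q (set_sum h B) \<le> real (card B) powr (1 / p)"
    by (simp add: lp_lq_norm_def)
qed (use J in auto)

definition coordinate_space :: "real \<Rightarrow> real \<Rightarrow> nat \<Rightarrow> nat \<Rightarrow> blockseq set" where
  "coordinate_space p q m i = {x \<in> block_space p q m. \<forall>j. j \<noteq> i \<longrightarrow> x m j = 0}"

text \<open>Within one block the norm is an \<open>\<ell>_q\<close> norm, so coordinates play the
  part that blocks play in the whole space, with \<open>q\<close> in place of
  \<open>p\<close>.\<close>

lemma block_family_coordinates:
  assumes p: "p > 1" and q: "q > 1"
  shows "block_family p q q (block_space p q m) {..<m} (coordinate_space p q m) (\<lambda>i z. \<bar>z m i\<bar>)"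
proof -
  have nrm: "lp_lq_norm p q z powr q = (\<Sum>i<m. \<bar>z m i\<bar> powr q)" if "z \<in> block_space p q m" for z
    using q by (simp add: lp_lq_norm_block_space[OF p q that] block_qnorm_def powr_powr sum_nonneg)
  have unit: "\<bar>h m i\<bar> = 1"
    if i: "i < m" and h: "h \<in> coordinate_space p q m i" "lp_lq_norm p q h = 1" for h i
  proof -
    have "(\<Sum>j<m. \<bar>h m j\<bar> powr q) = (\<Sum>j\<in>{i}. \<bar>h m j\<bar> powr q)"
      using i h by (intro sum.mono_neutral_right) (auto simp: coordinate_space_def)
    then have "\<bar>h m i\<bar> powr q = 1 powr q" using nrm[of h] h by (simp add: coordinate_space_def)
    then show ?thesis by (rule powr_base_inj) (use q in simp_all)
  qed
  show ?thesis
    unfolding block_family_def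
  proof (intro conjI ballI allI impI)
    show "linear_subspace (block_space p q m)" using block_space_subspace[OF p q] .
    show "block_space p q m \<subseteq> lp_lq_space p q" by (auto simp: block_space_def)
    show "coordinate_space p q m i \<subseteq> block_space p q m" for i by (auto simp: coordinate_space_def)
    show "finite {..<m}" by simp
    show "0 \<le> \<bar>z m i\<bar>" for z :: blockseq and i by simp
  next
    fix z i h and s :: real
    assume z: "z \<in> block_space p q m" and i: "i \<in> {..<m}" and h: "h \<in> coordinate_space p q m i"
      and s: "lp_lq_norm p q h = 1 \<and> \<bar>z m i\<bar> \<le> \<bar>s\<bar>"
    define w where "w = lincomb 1 z s h"
    have w: "w \<in> block_space p q m"
      using z h block_space_subspace[OF p q, of m]
      by (simp add: w_def linear_subspace_def coordinate_space_def)
    have "\<bar>s\<bar> = \<bar>s * h m i\<bar>" using unit[of i h] i h s by (simp add: abs_mult)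
    also have "\<dots> \<le> \<bar>w m i\<bar> + \<bar>z m i\<bar>" by (simp add: w_def lincomb_def)
    finally have le: "(\<bar>s\<bar> - \<bar>z m i\<bar>) powr q \<le> \<bar>w m i\<bar> powr q"
      using s q by (intro powr_mono2) auto
    have "(\<Sum>j\<in>{..<m} - {i}. \<bar>w m j\<bar> powr q) = (\<Sum>j\<in>{..<m} - {i}. \<bar>z m j\<bar> powr q)"
      using h by (intro sum.cong) (auto simp: w_def lincomb_def coordinate_space_def)
    then have "lp_lq_norm p q w powr q - \<bar>w m i\<bar> powr q = lp_lq_norm p q z powr q - \<bar>z m i\<bar> powr q"
      using i by (simp add: nrm[OF w] nrm[OF z] sum.remove[of "{..<m}" i])
    with le show "lp_lq_norm p q z powr q - \<bar>z m i\<bar> powr q + (\<bar>s\<bar> - \<bar>z m i\<bar>) powr q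
        \<le> lp_lq_norm p q (lincomb 1 z s h) powr q"
      by (simp add: w_def)
  next
    fix z assume "z \<in> block_space p q m"
    then show "(\<Sum>i<m. \<bar>z m i\<bar> powr q) \<le> lp_lq_norm p q z powr q" by (simp add: nrm)
  next
    fix h :: "nat \<Rightarrow> blockseq" and B
    assume B: "B \<subseteq> {..<m} \<and> (\<forall>i\<in>B. h i \<in> coordinate_space p q m i \<and> lp_lq_norm p q (h i) = 1)"
    have finB: "finite B" using B finite_subset by blast
    have "set_sum h B m j = (if j \<in> B then h j m j else 0)" for j
    proof -
      have "set_sum h B m j = (\<Sum>i\<in>B. if j = i then h i m j else 0)"
        unfolding set_sum_def using B by (intro sum.cong) (auto simp: coordinate_space_def)
      then show ?thesis using finB by simp
    qed
    then have "\<bar>set_sum h B m j\<bar> powr q = (if j \<in> B then 1 else 0)" if "j < m" for j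
      using B unit[of j "h j"] that by auto
    then have "(\<Sum>j<m. \<bar>set_sum h B m j\<bar> powr q) = (\<Sum>j<m. if j \<in> B then 1 else 0)"
      by (intro sum.cong) auto
    also have "\<dots> = real (card B)"
      using B by (simp add: sum.If_cases Int_absorb1)
    finally have "block_qnorm q (set_sum h B) m = real (card B) powr (1 / q)"
      by (simp add: block_qnorm_def)
    moreover have "set_sum h B \<in> block_space p q m"
    proof -
      have "set_sum h B = vec_sum (\<lambda>_. 1) h B" by (simp add: set_sum_def vec_sum_def)
      also have "\<dots> \<in> block_space p q m"
        using B by (intro vec_sum_in_subspace block_space_subspace p q finB) (auto simp: coordinate_space_def)
      finally show ?thesis .
    qed
    ultimately show "lp_lq_norm p q (set_sum h B) \<le> real (card B) powr (1 / q)"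
      by (simp add: lp_lq_norm_block_space[OF p q])
  qed
qed

definition unit_vector :: "nat \<Rightarrow> nat \<Rightarrow> blockseq" where
  "unit_vector m i = (\<lambda>n j. if n = m \<and> j = i then 1 else 0)"

lemma
  assumes p: "p > 1" and q: "q > 1" and i: "i < m"
  shows unit_vector_in: "unit_vector m i \<in> coordinate_space p q m i"
    and norm_unit_vector: "lp_lq_norm p q (unit_vector m i) = 1"
proof -
  have b: "block_qnorm q (unit_vector m i) n = (if n = m then 1 else 0)" for n
  proof -
    have "(\<Sum>j<n. \<bar>unit_vector m i n j\<bar> powr q) = (\<Sum>j<n. if j = i then (if n = m then 1 else 0) else 0)"
      by (intro sum.cong) (auto simp: unit_vector_def)
    then show ?thesis using i by (simp add: block_qnorm_def)
  qed
  then have "(\<lambda>n. block_qnorm q (unit_vector m i) n powr p) = (\<lambda>n. if n = m then 1 else 0)"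
    by auto
  moreover have "summable (\<lambda>n. if n = m then 1 else 0 :: real)"
    using sums_single[of m "\<lambda>_. 1::real"] by (simp add: sums_iff)
  ultimately show *: "unit_vector m i \<in> coordinate_space p q m i"
    using i by (auto simp: coordinate_space_def block_space_def lp_lq_space_def unit_vector_def)
  show "lp_lq_norm p q (unit_vector m i) = 1"
    using lp_lq_norm_block_space[OF p q, of "unit_vector m i" m] * b by (simp add: coordinate_space_def)
qed

context separating begin

text \<open>If \<open>r\<close> is not an even integer, every even order from \<open>r\<close> up to
  \<open>N\<close> exceeds \<open>r\<close> by a fixed \<sigma>. These orders contribute at most
  \<open>(N + 1) * K * t powr (r + \<sigma>)\<close>, too little for small \<open>t\<close> to reach
  3/8 of \<open>t powr r\<close>.\<close>

lemma exponent_even: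
  assumes r: "r > 0"
    and fam: "\<And>M. \<exists>Z J E g. block_family p q r Z J E g \<and> M \<le> card J \<and> (\<forall>j\<in>J. \<exists>h\<in>E j. nrm h = 1)"
  shows "\<exists>a::nat. r = 2 * real a"
proof (rule ccontr)
  assume no: "\<nexists>a::nat. r = 2 * real a"
  obtain \<delta> K where \<delta>: "0 < \<delta>" "\<delta> < 1" and K: "0 \<le> K"
    and high: "\<And>t \<eta>. 0 < t \<Longrightarrow> t < \<delta> \<Longrightarrow> 0 < \<eta> \<Longrightarrow> \<exists>M. high_order_large r t \<eta> K M"
    using high_order_coefficients_large r by blast
  define G where "G = {k. k \<le> N \<and> even k \<and> r \<le> real k}"
  have finG: "finite G" by (rule finite_subset[of _ "{..N}"]) (auto simp: G_def)
  have cardG: "card G \<le> N + 1"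
    using card_mono[of "{..N}" G] by (auto simp: G_def)
  \<comment> \<open>The inserted 1 keeps the minimum defined when \<open>G\<close> is empty.\<close>
  define \<sigma> where "\<sigma> = Min (insert 1 ((\<lambda>k. real k - r) ` G))"
  have "r < real k" if "k \<in> G" for k
  proof -
    have "r \<noteq> real k" using no that by (auto simp: G_def elim!: evenE)
    then show ?thesis using that by (simp add: G_def)
  qed
  then have \<sigma>: "\<sigma> > 0" using finG by (auto simp: \<sigma>_def)
  have \<sigma>G: "r + \<sigma> \<le> real k" if "k \<in> G" for k
  proof -
    have "\<sigma> \<le> real k - r" unfolding \<sigma>_def using that finG by (intro Min_le) auto
    then show ?thesis by simp
  qed
  obtain \<theta> where \<theta>: "0 < \<theta>" "\<theta> < 1" "((N + 1) * K) * \<theta> powr \<sigma> \<le> 1/8"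
    using small_powr[OF \<sigma>, of "1/8" "(N + 1) * K"] K by auto
  define t where "t = \<delta> * \<theta>"
  have t: "0 < t" "t < \<delta>" "t < 1" "t \<le> \<theta>"
  proof -
    show "0 < t" using \<delta> \<theta> by (simp add: t_def)
    show *: "t < \<delta>" using \<delta> \<theta> by (simp add: t_def)
    then show "t < 1" using \<delta> by simp
    show "t \<le> \<theta>" using \<delta> \<theta> by (simp add: t_def)
  qed
  define \<eta> where "\<eta> = t powr r / 8"
  have \<eta>: "\<eta> > 0" using t by (simp add: \<eta>_def)
  from high[OF t(1,2) \<eta>] obtain M where M: "high_order_large r t \<eta> K M" by blast
  from fam[of M] obtain Z J E g where
    Z: "block_family p q r Z J E g" "M \<le> card J" and unit: "\<forall>j\<in>J. \<exists>h\<in>E j. nrm h = 1" by blast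
  from high_order_largeD[OF M Z] obtain x j where j: "j \<in> J" and xj: "\<forall>h\<in>E j. nrm h = 1 \<longrightarrow>
      (\<forall>k\<le>N. \<bar>T k x h\<bar> \<le> K) \<and> t powr r / 2 - \<eta> \<le> (\<Sum>k\<in>G. t ^ k * T k x h)"
    unfolding G_def by blast
  from unit j obtain h where h: "h \<in> E j" "nrm h = 1" by blast
  from xj[rule_format, OF h] have TK: "\<And>k. k \<le> N \<Longrightarrow> \<bar>T k x h\<bar> \<le> K"
    and ge: "t powr r / 2 - \<eta> \<le> (\<Sum>k\<in>G. t ^ k * T k x h)" by blast+
  have "(\<Sum>k\<in>G. t ^ k * T k x h) \<le> (\<Sum>k\<in>G. t powr (r + \<sigma>) * K)"
  proof (intro sum_mono)
    fix k assume k: "k \<in> G"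
    have "t ^ k * T k x h \<le> t ^ k * K"
      using TK[of k] k t by (intro mult_left_mono) (auto simp: G_def)
    also have "t ^ k * K = t powr real k * K" using t by (simp add: powr_realpow)
    also have "\<dots> \<le> t powr (r + \<sigma>) * K"
      using K t \<sigma>G[OF k] by (intro mult_right_mono powr_mono') auto
    finally show "t ^ k * T k x h \<le> t powr (r + \<sigma>) * K" .
  qed
  also have "\<dots> \<le> (N + 1) * (t powr (r + \<sigma>) * K)"
    using cardG K by (simp only: sum_constant) (intro mult_right_mono, auto)
  also have "\<dots> = t powr r * (((N + 1) * K) * t powr \<sigma>)" by (simp add: powr_add)
  also have "\<dots> \<le> t powr r * (((N + 1) * K) * \<theta> powr \<sigma>)"
    using t \<sigma> K by (intro mult_left_mono powr_mono2) auto
  also have "\<dots> \<le> t powr r * (1/8)" using \<theta> by (intro mult_left_mono) auto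
  finally have "(\<Sum>k\<in>G. t ^ k * T k x h) \<le> t powr r * (1/8)" .
  moreover have "0 < t powr r" using t by simp
  ultimately show False using ge \<eta>_def by linarith
qed

lemma p_even: "\<exists>a::nat. p = 2 * real a"
proof (rule exponent_even)
  fix M
  show "\<exists>Z J E g. block_family p q p Z J E g \<and> M \<le> card J \<and> (\<forall>j\<in>J. \<exists>h\<in>E j. nrm h = 1)"
  proof (intro exI conjI ballI)
    \<comment> \<open>Block 0 has no coordinates and hence no unit vector, so the indices start at
      1.\<close>
    show "block_family p q p X {1..M} (block_space p q) (\<lambda>j z. block_qnorm q z j)"
      by (rule block_family_blocks[OF p q]) simp
    fix j assume "j \<in> {1..M}"
    then show "\<exists>h\<in>block_space p q j. nrm h = 1"
      using unit_vector_in[OF p q, of 0 j] norm_unit_vector[OF p q, of 0 j]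
      by (auto simp: coordinate_space_def)
  qed simp
qed (use p in simp)

lemma q_even: "\<exists>b::nat. q = 2 * real b"
proof (rule exponent_even)
  fix M
  show "\<exists>Z J E g. block_family p q q Z J E g \<and> M \<le> card J \<and> (\<forall>j\<in>J. \<exists>h\<in>E j. nrm h = 1)"
  proof (intro exI conjI ballI)
    show "block_family p q q (block_space p q M) {..<M} (coordinate_space p q M) (\<lambda>i z. \<bar>z M i\<bar>)"
      by (rule block_family_coordinates[OF p q])
    fix j assume "j \<in> {..<M}"
    then show "\<exists>h\<in>coordinate_space p q M j. nrm h = 1"
      using unit_vector_in[OF p q, of j M] norm_unit_vector[OF p q, of j M] by auto
  qed simp
qed (use q in simp)

end

section \<open>The quotient of the exponents\<close>

context separating begin

text \<open>Now order \<open>n\<close> itself can produce \<open>t ^ n\<close>. The higher orders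
  give at most \<open>t ^ n / 8\<close> and \<eta> is \<open>t ^ n / 8\<close>, which leaves 1/2 -
  1/8 - 1/8 = 1/4 for the coefficient. \<open>K\<close> is uniform in \<open>L\<close>, so the
  two-sided bound holds on arbitrarily large blocks.\<close>

lemma leading_coefficient_bounds:
  assumes a: "p = real n" and n: "even n"
  shows "\<exists>K\<ge>0. \<forall>L. \<exists>x\<in>X. \<exists>j>L. n \<le> N \<and>
    (\<forall>h\<in>block_space p q j. nrm h = 1 \<longrightarrow> 1/4 \<le> T n x h \<and> T n x h \<le> K)"
proof -
  obtain \<delta> K where \<delta>: "0 < \<delta>" "\<delta> < 1" and K: "0 \<le> K"
    and high: "\<And>r t \<eta>. 0 < r \<Longrightarrow> 0 < t \<Longrightarrow> t < \<delta> \<Longrightarrow> 0 < \<eta> \<Longrightarrow> \<exists>M. high_order_large r t \<eta> K M"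
    using high_order_coefficients_large by blast
  define D where "D = (N + 1) * K + 1"
  have den: "D > 0" using K by (simp add: D_def add_nonneg_pos)
  define t where "t = min (\<delta> / 2) (1 / (8 * D))"
  have t: "0 < t" "t < \<delta>" "t < 1" using \<delta> den by (auto simp: t_def)
  have "((N + 1) * K) * t \<le> D * (1 / (8 * D))"
    using K t den by (intro mult_mono) (auto simp: t_def D_def)
  then have Kt: "((N + 1) * K) * t \<le> 1/8" using den by simp
  define \<eta> where "\<eta> = t ^ n / 8"
  have tn: "0 < t ^ n" using t by simp
  have \<eta>: "\<eta> > 0" using tn by (simp add: \<eta>_def)
  define G where "G = {k. k \<le> N \<and> even k \<and> p \<le> real k}"
  have finG: "finite G" by (rule finite_subset[of _ "{..N}"]) (auto simp: G_def)
  from high[OF _ t(1,2) \<eta>, of p] p obtain M where M: "high_order_large p t \<eta> K M" by auto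
  have "\<exists>x\<in>X. \<exists>j>L. n \<le> N \<and>
    (\<forall>h\<in>block_space p q j. nrm h = 1 \<longrightarrow> 1/4 \<le> T n x h \<and> T n x h \<le> K)" for L
  proof -
    \<comment> \<open>The index set has exactly \<open>M\<close> elements, all beyond
      \<open>L\<close>.\<close>
    have "block_family p q p X {Suc L..L + M} (block_space p q) (\<lambda>j z. block_qnorm q z j)"
      by (rule block_family_blocks[OF p q]) simp
    from high_order_largeD[OF M this] obtain x j where x: "x \<in> X" and j: "j \<in> {Suc L..L + M}"
      and xj: "\<forall>h\<in>block_space p q j. nrm h = 1 \<longrightarrow> (\<forall>k\<le>N. \<bar>T k x h\<bar> \<le> K) \<and>
        t powr p / 2 - \<eta> \<le> (\<Sum>k\<in>G. t ^ k * T k x h)"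
      unfolding G_def by auto
    have *: "n \<le> N \<and> 1/4 \<le> T n x h \<and> T n x h \<le> K" if h: "h \<in> block_space p q j" "nrm h = 1" for h
    proof -
      have TK: "\<And>k. k \<le> N \<Longrightarrow> \<bar>T k x h\<bar> \<le> K"
        and ge: "t powr p / 2 - \<eta> \<le> (\<Sum>k\<in>G. t ^ k * T k x h)"
        using xj[rule_format, OF h] by blast+
      have tp: "t powr p = t ^ n" using t a by (simp add: powr_realpow)
      have "(\<Sum>k\<in>G - {n}. t ^ k * T k x h) \<le> (\<Sum>k\<in>G - {n}. t ^ Suc n * K)"
      proof (intro sum_mono)
        fix k assume k: "k \<in> G - {n}"
        have "t ^ k * T k x h \<le> t ^ k * K"
          using TK[of k] k t by (intro mult_left_mono) (auto simp: G_def)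
        also have "\<dots> \<le> t ^ Suc n * K"
          using K t k a by (intro mult_right_mono power_decreasing) (auto simp: G_def)
        finally show "t ^ k * T k x h \<le> t ^ Suc n * K" .
      qed
      also have "\<dots> \<le> (N + 1) * (t ^ Suc n * K)"
      proof -
        have "card (G - {n}) \<le> card {..N}" by (intro card_mono) (auto simp: G_def)
        then have "real (card (G - {n})) \<le> real (N + 1)" by simp
        then show ?thesis using K t by (simp only: sum_constant) (intro mult_right_mono, auto)
      qed
      also have "\<dots> = t ^ n * (((N + 1) * K) * t)" by simp
      also have "\<dots> \<le> t ^ n * (1/8)" using tn Kt by (intro mult_left_mono) auto
      finally have rest: "(\<Sum>k\<in>G - {n}. t ^ k * T k x h) \<le> t ^ n / 8" by simp
      have nN: "n \<le> N"
      proof (rule ccontr)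
        \<comment> \<open>Without an order \<open>n\<close> among those available, the higher orders
          alone would have to reach 3/8 of \<open>t ^ n\<close>.\<close>
        assume "\<not> n \<le> N"
        then have "G - {n} = G" by (auto simp: G_def)
        then show False using rest ge tn by (simp add: tp \<eta>_def)
      qed
      then have nG: "n \<in> G" using a n by (simp add: G_def)
      have "t ^ n / 2 - \<eta> \<le> t ^ n * T n x h + t ^ n / 8"
        using ge rest sum.remove[OF finG nG, of "\<lambda>k. t ^ k * T k x h"] by (simp add: tp)
      then have "t ^ n * (1/4) \<le> t ^ n * T n x h" by (simp add: \<eta>_def)
      then have "1/4 \<le> T n x h" using tn by (simp only: mult_le_cancel_left_pos)
      then show ?thesis using nN TK[OF nN] by auto
    qed
    have "unit_vector j 0 \<in> block_space p q j" "nrm (unit_vector j 0) = 1"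
      using unit_vector_in[OF p q, of 0 j] norm_unit_vector[OF p q, of 0 j] j
      by (auto simp: coordinate_space_def)
    from *[OF this] have "n \<le> N" by blast
    moreover have "j > L" using j by simp
    ultimately show ?thesis using * x by blast
  qed
  then show ?thesis using K by blast
qed

text \<open>On sums of coordinate vectors in a large block the coefficient of order \<open>n\<close>
  is comparable to \<open>card B powr (p / q)\<close>. Its Bernoulli mean is a polynomial in
  \<theta> of degree at most \<open>n\<close>, and after division by \<open>L powr s\<close> the
  mean of the comparison function approximates \<open>\<theta> powr s\<close> uniformly. The growth
  lemma then makes \<open>p / q\<close> an integer.\<close>

lemma p_multiple_of_q:
  assumes a: "p = real n" and n: "even n"
  shows "\<exists>k::nat. p = real k * q"
proof -
  obtain K where K: "K \<ge> 0" and lead: "\<And>L. \<exists>x\<in>X. \<exists>j>L. n \<le> N \<and>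
    (\<forall>h\<in>block_space p q j. nrm h = 1 \<longrightarrow> 1/4 \<le> T n x h \<and> T n x h \<le> K)"
    using leading_coefficient_bounds[OF a n] by blast
  define s where "s = p / q"
  have s: "s > 0" using p q by (simp add: s_def)
  have "\<exists>m::nat. s = real m"
  proof (rule nat_exponent_if_polynomial_growth[OF s, of "1/4" K n])
    fix e :: real assume e: "e > 0"
    \<comment> \<open>The approximation error enters the upper bound multiplied by \<open>K\<close>
      and the lower bound by 1/4.\<close>
    define e' where "e' = e / (K + 1)"
    have e': "e' > 0" "K * e' \<le> e" "e' \<le> e" using e K by (auto simp: e'_def field_simps)
    have "continuous_on {0..1} (\<lambda>x::real. x powr s)"
      using s by (intro continuous_on_powr') (auto intro: continuous_intros)
    from Bernstein_Weierstrass[OF this e'(1)] obtain L0 where L0: "\<And>L x. L0 \<le> L \<Longrightarrow> x \<in> {0..1} \<Longrightarrow>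
        \<bar>x powr s - (\<Sum>k\<le>L. (real k / real L) powr s * Bernstein L k x)\<bar> < e'" by blast
    define L where "L = Suc L0"
    have L: "L0 \<le> L" "L > 0" by (auto simp: L_def)
    \<comment> \<open>\<open>L\<close> is fixed by the accuracy first; then a block with more than
      \<open>L\<close> coordinates is taken.\<close>
    from lead[of L] obtain x j where x: "x \<in> X" and j: "j > L" and nN: "n \<le> N"
      and bounds: "\<And>h. h \<in> block_space p q j \<Longrightarrow> nrm h = 1 \<Longrightarrow> 1/4 \<le> T n x h \<and> T n x h \<le> K"
      by blast
    define u where "u = unit_vector j"
    have u: "u i \<in> coordinate_space p q j i" "nrm (u i) = 1" if "i < L" for i
      using unit_vector_in[OF p q, of i j] norm_unit_vector[OF p q, of i j] that j by (auto simp: u_def)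
    have uX: "u i \<in> X" if "i \<in> {..<L}" for i
      using u[of i] that by (auto simp: coordinate_space_def block_space_def)
    have F: "1/4 * real (card B) powr s \<le> T n x (set_sum u B) \<and> T n x (set_sum u B) \<le> K * real (card B) powr s"
      if B: "B \<subseteq> {..<L}" for B
    proof -
      have finB: "finite B" using B finite_subset by blast
      have SB: "set_sum u B \<in> block_space p q j"
      proof -
        have "set_sum u B = vec_sum (\<lambda>_. 1) u B" by (simp add: set_sum_def vec_sum_def)
        also have "\<dots> \<in> block_space p q j"
          using B u by (intro vec_sum_in_subspace block_space_subspace p q finB)
            (auto simp: coordinate_space_def)
        finally show ?thesis .
      qed
      have val: "set_sum u B j i = (if i \<in> B then 1 else 0)" for i
        using finB by (simp add: set_sum_def u_def unit_vector_def if_distrib)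
      have "(\<Sum>i<j. \<bar>set_sum u B j i\<bar> powr q) = (\<Sum>i<j. if i \<in> B then 1 else 0)"
        by (intro sum.cong) (auto simp: val)
      also have "\<dots> = real (card B)"
      proof -
        have "{..<j} \<inter> B = B" using B j by auto
        then show ?thesis by (simp add: sum.If_cases)
      qed
      finally have nB: "nrm (set_sum u B) = real (card B) powr (1 / q)"
        by (simp add: lp_lq_norm_block_space[OF p q SB] block_qnorm_def)
      define R where "R = real (card B) powr (1 / q)"
      have SX: "set_sum u B \<in> X" using SB by (simp add: block_space_def)
      \<comment> \<open>\<open>R\<close> is the norm of the sum over \<open>B\<close>; homogeneity
        of order \<open>n = p\<close> turns it into the exponent \<open>p / q\<close>.\<close>
      have Rn: "R ^ n = real (card B) powr s" if "R > 0"
        using that by (simp add: powr_realpow[symmetric] a[symmetric] R_def powr_powr s_def)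
      show ?thesis
      proof (cases "B = {}")
        case True
        \<comment> \<open>The zero vector is written as a multiple of a unit vector, so homogeneity
          of positive order gives the value 0.\<close>
        then have "set_sum u B = (\<lambda>i k. 0 * u 0 i k)" by (simp add: set_sum_def)
        moreover have "n > 0" using a p by (cases n) auto
        ultimately have "T n x (set_sum u B) = 0"
          using T_scale[OF _ x nN, of "u 0" 0] uX[of 0] L by simp
        then show ?thesis using True by simp
      next
        case False
        then have R: "R > 0" using finB by (simp add: R_def card_gt_0_iff)
        define h where "h = (\<lambda>i k. (1/R) * set_sum u B i k)"
        have "nrm h = 1" using nrm_scale[OF SX, of "1/R"] R nB by (simp add: h_def R_def)
        moreover have "h \<in> block_space p q j"
          using SB scale_in[OF SX, of "1/R"] by (simp add: block_space_def h_def)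
        ultimately have hb: "1/4 \<le> T n x h" "T n x h \<le> K" "h \<in> X"
          using bounds[of h] by (auto simp: block_space_def)
        have "set_sum u B = (\<lambda>i k. R * h i k)" using R by (simp add: h_def)
        then have "T n x (set_sum u B) = R ^ n * T n x h"
          using T_scale[OF hb(3) x nN, of R] by simp
        then show ?thesis
          using hb(1,2) R by (simp add: Rn[symmetric] mult.commute)
      qed
    qed
    have fin: "finite {..<L}" by simp
    from taylor_coeff_set_sum[OF poly subspace fin uX x nN]
    obtain c where "\<forall>B. B \<subseteq> {..<L} \<longrightarrow> T n x (set_sum u B) = word_poly {..<L} n c B" ..
    note c = this[rule_format]
    define b where "b = (\<lambda>d. (\<Sum>I\<in>{I\<in>words {..<L} n. card (set I) = d}. c I) / real L powr s)"
    have Ls: "real L powr s > 0" using L by simp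
    have "1/4 * \<theta> powr s - e \<le> (\<Sum>d\<le>n. \<theta> ^ d * b d) \<and> (\<Sum>d\<le>n. \<theta> ^ d * b d) \<le> K * \<theta> powr s + e"
      if \<theta>: "0 \<le> \<theta> \<and> \<theta> \<le> 1" for \<theta>
    proof -
      define S where "S = (\<Sum>k\<le>L. (real k / real L) powr s * Bernstein L k \<theta>)"
      have S: "\<bar>\<theta> powr s - S\<bar> < e'" using L0[OF L(1), of \<theta>] \<theta> by (simp add: S_def)
      \<comment> \<open>Up to the factor \<open>L powr s\<close>, this mean is the Bernstein
        polynomial of the power function with exponent \<open>s\<close>.\<close>
      have mean: "bernoulli_mean \<theta> {..<L} (\<lambda>B. real (card B) powr s) = real L powr s * S"
        using L unfolding S_def sum_distrib_left
        by (subst bernoulli_mean_card) (auto simp: powr_divide intro!: sum.cong)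
      have sum: "(\<Sum>d\<le>n. \<theta> ^ d * b d) = bernoulli_mean \<theta> {..<L} (word_poly {..<L} n c) / real L powr s"
        by (simp add: bernoulli_mean_word_poly b_def flip: sum_divide_distrib)
      have "bernoulli_mean \<theta> {..<L} (\<lambda>B. 1/4 * real (card B) powr s)
          \<le> bernoulli_mean \<theta> {..<L} (word_poly {..<L} n c)"
        using \<theta> F c by (intro bernoulli_mean_mono) auto
      then have "1/4 * S \<le> (\<Sum>d\<le>n. \<theta> ^ d * b d)"
        using Ls unfolding sum bernoulli_mean_cmult mean by (simp add: field_simps)
      moreover have "bernoulli_mean \<theta> {..<L} (word_poly {..<L} n c)
          \<le> bernoulli_mean \<theta> {..<L} (\<lambda>B. K * real (card B) powr s)"
        using \<theta> F c by (intro bernoulli_mean_mono) auto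
      then have "(\<Sum>d\<le>n. \<theta> ^ d * b d) \<le> K * S"
        using Ls unfolding sum bernoulli_mean_cmult mean by (simp add: field_simps)
      moreover have "K * S \<le> K * \<theta> powr s + K * e'"
        using S K by (simp only: distrib_left[symmetric]) (intro mult_left_mono, auto)
      ultimately show ?thesis using S e' by linarith
    qed
    then show "\<exists>b. \<forall>\<theta>. 0 \<le> \<theta> \<and> \<theta> \<le> 1 \<longrightarrow>
      1/4 * \<theta> powr s - e \<le> (\<Sum>d\<le>n. \<theta> ^ d * b d) \<and> (\<Sum>d\<le>n. \<theta> ^ d * b d) \<le> K * \<theta> powr s + e"
      by blast
  qed (use K in auto)
  then show ?thesis using q by (auto simp: s_def field_simps)
qed

end

section \<open>The norm as a polynomial\<close>

text \<open>Every factor is at most the maximum, whose power is one of the summands. This crude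
  bound suffices for summability.\<close>

lemma prod_le_sum_power:
  fixes f :: "'i \<Rightarrow> real"
  assumes "finite I" "I \<noteq> {}" "\<And>i. i \<in> I \<Longrightarrow> 0 \<le> f i"
  shows "prod f I \<le> (\<Sum>i\<in>I. f i ^ card I)"
proof -
  have "Max (f ` I) \<in> f ` I" using assms by (intro Max_in) auto
  then obtain j where j: "j \<in> I" "Max (f ` I) = f j" by auto
  have "f i \<le> f j" if "i \<in> I" for i
    unfolding j(2)[symmetric] using that assms by (intro Max_ge) auto
  then have "prod f I \<le> (\<Prod>i\<in>I. f j)" using assms(3) by (intro prod_mono) auto
  also have "\<dots> \<le> (\<Sum>i\<in>I. f i ^ card I)"
    using member_le_sum[of j I "\<lambda>i. f i ^ card I"] assms j by simp
  finally show ?thesis .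
qed

lemma sum_power_le:
  fixes f :: "'i \<Rightarrow> real"
  assumes "finite I" "I \<noteq> {}" "\<And>i. i \<in> I \<Longrightarrow> 0 \<le> f i"
  shows "(\<Sum>i\<in>I. f i) ^ k \<le> real (card I) ^ k * (\<Sum>i\<in>I. f i ^ k)"
proof -
  have "Max (f ` I) \<in> f ` I" using assms by (intro Max_in) auto
  then obtain j where j: "j \<in> I" "Max (f ` I) = f j" by auto
  have "f i \<le> f j" if "i \<in> I" for i
    unfolding j(2)[symmetric] using that assms by (intro Max_ge) auto
  then have "(\<Sum>i\<in>I. f i) \<le> (\<Sum>i\<in>I. f j)" by (intro sum_mono) auto
  then have "(\<Sum>i\<in>I. f i) ^ k \<le> (real (card I) * f j) ^ k"
    using assms by (intro power_mono sum_nonneg) auto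
  also have "\<dots> = real (card I) ^ k * f j ^ k" by (simp add: power_mult_distrib)
  also have "f j ^ k \<le> (\<Sum>i\<in>I. f i ^ k)"
    using member_le_sum[of j I "\<lambda>i. f i ^ k"] assms j by simp
  finally show ?thesis by (simp add: mult_left_mono)
qed

text \<open>A polarisation of the block term \<open>(\<Sum>i<n. x n i ^ Q) ^ k\<close>. The
  \<open>k * Q\<close> arguments are read as \<open>k\<close> rows of length \<open>Q\<close>, and
  argument \<open>l\<close> of row \<open>j\<close> stands at position
  \<open>j * Q + l\<close>.\<close>

definition norm_form_block :: "nat \<Rightarrow> nat \<Rightarrow> blockseq list \<Rightarrow> nat \<Rightarrow> real" where
  "norm_form_block k Q xs n = (\<Prod>j<k. \<Sum>i<n. \<Prod>l<Q. (xs ! (j * Q + l)) n i)"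

text \<open>Each of the \<open>k\<close> factors is at most the sum \<open>S n\<close> of the
  \<open>q\<close>-th powers of the block norms of all arguments. Since \<open>p = k * q\<close>,
  the \<open>k\<close>-th power of \<open>S n\<close> is dominated by the sum of their
  \<open>p\<close>-th powers, which is summable.\<close>

lemma norm_form_block_summable:
  assumes q: "q = real Q" "q > 1" and p: "p = real k * q" "p > 1"
    and xs: "length xs = k * Q" "set xs \<subseteq> lp_lq_space p q"
  shows "summable (norm_form_block k Q xs)"
proof -
  have Q: "Q > 0" and k: "k > 0" using p q by (auto intro!: Nat.gr0I)
  have idx: "j * Q + l < k * Q" if "j < k" "l < Q" for j l
  proof -
    have "j * Q + l < Suc j * Q" using that by simp
    also have "\<dots> \<le> k * Q" using that by (intro mult_right_mono) auto
    finally show ?thesis .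
  qed
  define S where "S = (\<lambda>n. \<Sum>m<k * Q. block_qnorm q (xs ! m) n powr q)"
  have block: "block_qnorm q (xs ! m) n powr q = (\<Sum>i<n. \<bar>(xs ! m) n i\<bar> ^ Q)" for m n
    using q Q by (simp add: block_qnorm_def powr_powr sum_nonneg powr_realpow')
  have S: "\<bar>\<Sum>i<n. \<Prod>l<Q. (xs ! (j * Q + l)) n i\<bar> \<le> S n" if j: "j < k" for j n
  proof -
    have "\<bar>\<Sum>i<n. \<Prod>l<Q. (xs ! (j * Q + l)) n i\<bar> \<le> (\<Sum>i<n. \<Prod>l<Q. \<bar>(xs ! (j * Q + l)) n i\<bar>)"
      by (rule order_trans[OF sum_abs]) (simp add: abs_prod)
    also have "\<dots> \<le> (\<Sum>i<n. \<Sum>l<Q. \<bar>(xs ! (j * Q + l)) n i\<bar> ^ Q)"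
      using prod_le_sum_power[of "{..<Q}"] Q by (intro sum_mono) (force simp: lessThan_empty_iff)
    also have "\<dots> = (\<Sum>l<Q. block_qnorm q (xs ! (j * Q + l)) n powr q)"
      unfolding block by (rule sum.swap)
    also have "\<dots> = (\<Sum>m\<in>(\<lambda>l. j * Q + l) ` {..<Q}. block_qnorm q (xs ! m) n powr q)"
      by (subst sum.reindex) (auto simp: inj_on_def)
    also have "\<dots> \<le> S n"
      unfolding S_def using idx[OF j] by (intro sum_mono2) auto
    finally show ?thesis .
  qed
  have bound: "norm (norm_form_block k Q xs n)
      \<le> real (k * Q) ^ k * (\<Sum>m<k * Q. block_qnorm q (xs ! m) n powr p)" for n
  proof -
    have "norm (norm_form_block k Q xs n) \<le> (\<Prod>j<k. S n)"
      unfolding norm_form_block_def real_norm_def abs_prod using S by (intro prod_mono) auto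
    also have "\<dots> = S n ^ k" by simp
    also have "\<dots> \<le> real (k * Q) ^ k * (\<Sum>m<k * Q. (block_qnorm q (xs ! m) n powr q) ^ k)"
      unfolding S_def using sum_power_le[of "{..<k * Q}" "\<lambda>m. block_qnorm q (xs ! m) n powr q" k] Q k
      by (simp add: lessThan_empty_iff)
    finally show ?thesis
      using k by (simp add: powr_realpow'[symmetric] powr_powr p mult.commute)
  qed
  have "summable (\<lambda>n. real (k * Q) ^ k * (\<Sum>m<k * Q. block_qnorm q (xs ! m) n powr p))"
  proof (intro summable_mult summable_sum)
    fix m assume "m \<in> {..<k * Q}"
    then have "xs ! m \<in> lp_lq_space p q" using xs by (metis lessThan_iff nth_mem subsetD)
    then show "summable (\<lambda>n. block_qnorm q (xs ! m) n powr p)" by (simp add: lp_lq_space_def)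
  qed
  from summable_comparison_test[OF _ this] bound show ?thesis by blast
qed

text \<open>Position \<open>m\<close> occurs only in row \<open>m div Q\<close>, column
  \<open>m mod Q\<close>, so the replaced vector enters linearly. \<open>R\<close> gathers all other
  factors and is independent of \<open>u\<close>, which gives additivity and homogeneity
  together.\<close>

lemma norm_form_block_update:
  assumes m: "m < k * Q" and len: "length xs = k * Q"
  shows "\<exists>R. \<forall>u. norm_form_block k Q (xs[m := u]) n = (\<Sum>i<n. u n i * R i)"
proof -
  define j0 l0 where "j0 = m div Q" and "l0 = m mod Q"
  have Q: "Q > 0" using m by (intro Nat.gr0I) auto
  have m_eq: "m = j0 * Q + l0" by (simp add: j0_def l0_def)
  have l0: "l0 < Q" using Q by (simp add: l0_def)
  have j0: "j0 < k" using m Q by (simp add: j0_def less_mult_imp_div_less)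
  have other: "xs[m := u] ! (j * Q + l) = xs ! (j * Q + l)" if "l < Q" "j \<noteq> j0 \<or> l \<noteq> l0" for u j l
  proof -
    have "(j * Q + l) div Q = j" "(j * Q + l) mod Q = l" using that by auto
    then have "m \<noteq> j * Q + l" using that by (auto simp: j0_def l0_def)
    then show ?thesis by simp
  qed
  define H where "H = (\<Prod>j\<in>{..<k} - {j0}. \<Sum>i<n. \<Prod>l<Q. (xs ! (j * Q + l)) n i)"
  define R where "R = (\<lambda>i. (\<Prod>l\<in>{..<Q} - {l0}. (xs ! (j0 * Q + l)) n i) * H)"
  have "norm_form_block k Q (xs[m := u]) n = (\<Sum>i<n. u n i * R i)" for u
  proof -
    have "norm_form_block k Q (xs[m := u]) n
        = (\<Sum>i<n. \<Prod>l<Q. (xs[m := u] ! (j0 * Q + l)) n i)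
          * (\<Prod>j\<in>{..<k} - {j0}. \<Sum>i<n. \<Prod>l<Q. (xs[m := u] ! (j * Q + l)) n i)"
      unfolding norm_form_block_def using j0 by (intro prod.remove) auto
    also have "(\<Prod>j\<in>{..<k} - {j0}. \<Sum>i<n. \<Prod>l<Q. (xs[m := u] ! (j * Q + l)) n i) = H"
      unfolding H_def by (intro prod.cong sum.cong refl) (simp add: other)
    also have "(\<Sum>i<n. \<Prod>l<Q. (xs[m := u] ! (j0 * Q + l)) n i)
        = (\<Sum>i<n. u n i * (\<Prod>l\<in>{..<Q} - {l0}. (xs ! (j0 * Q + l)) n i))"
    proof (intro sum.cong refl)
      fix i
      have "(\<Prod>l<Q. (xs[m := u] ! (j0 * Q + l)) n i) = (xs[m := u] ! (j0 * Q + l0)) n i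
          * (\<Prod>l\<in>{..<Q} - {l0}. (xs[m := u] ! (j0 * Q + l)) n i)"
        using l0 by (intro prod.remove) auto
      also have "xs[m := u] ! (j0 * Q + l0) = u" using m len by (simp flip: m_eq)
      also have "(\<Prod>l\<in>{..<Q} - {l0}. (xs[m := u] ! (j0 * Q + l)) n i)
          = (\<Prod>l\<in>{..<Q} - {l0}. (xs ! (j0 * Q + l)) n i)"
        by (intro prod.cong refl) (simp add: other)
      finally show "(\<Prod>l<Q. (xs[m := u] ! (j0 * Q + l)) n i)
          = u n i * (\<Prod>l\<in>{..<Q} - {l0}. (xs ! (j0 * Q + l)) n i)" .
    qed
    finally show ?thesis by (simp add: R_def sum_distrib_right mult.assoc)
  qed
  then show ?thesis by blast
qed

lemma norm_form_multilinear:
  assumes q: "q = real Q" "q > 1" and p: "p = real k * q" "p > 1"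
  shows "multilinear_on (lp_lq_space p q) (k * Q) (\<lambda>xs. \<Sum>n. norm_form_block k Q xs n)"
  unfolding multilinear_on_def
proof (intro allI impI ballI)
  fix xs m u v and a b :: real
  assume xs: "length xs = k * Q \<and> set xs \<subseteq> lp_lq_space p q" and m: "m < k * Q"
    and u: "u \<in> lp_lq_space p q" and v: "v \<in> lp_lq_space p q"
  have summ: "summable (norm_form_block k Q (xs[m := w]))" if "w \<in> lp_lq_space p q" for w
    using xs that set_update_subset_insert[of xs m w]
    by (intro norm_form_block_summable[OF q p]) auto
  have "norm_form_block k Q (xs[m := lincomb a u b v]) n
      = a * norm_form_block k Q (xs[m := u]) n + b * norm_form_block k Q (xs[m := v]) n" for n
  proof -
    obtain R where R: "\<And>w. norm_form_block k Q (xs[m := w]) n = (\<Sum>i<n. w n i * R i)"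
      using norm_form_block_update[OF m, of xs n] xs by blast
    show ?thesis
      by (simp add: R lincomb_def distrib_right sum.distrib sum_distrib_left mult.assoc)
  qed
  then show "(\<Sum>n. norm_form_block k Q (xs[m := lincomb a u b v]) n)
      = a * (\<Sum>n. norm_form_block k Q (xs[m := u]) n) + b * (\<Sum>n. norm_form_block k Q (xs[m := v]) n)"
    using summ[OF u] summ[OF v] by (simp add: suminf_add[symmetric] suminf_mult summable_mult)
qed

lemma norm_power_separating:
  assumes q: "q = real Q" "even Q" "q > 1" and p: "p = real k * q" "p > 1"
  shows "separating_polynomial p q (\<lambda>x. lp_lq_norm p q x powr p)"
  unfolding separating_polynomial_def
proof (intro conjI ballI allI impI)
  have Q: "Q > 0" and k: "k > 0" using p q by (auto intro!: Nat.gr0I)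
  have diag: "lp_lq_norm p q x powr p = (\<Sum>n. norm_form_block k Q (replicate (k * Q) x) n)"
    if x: "x \<in> lp_lq_space p q" for x
  proof -
    have "block_qnorm q x n powr p = norm_form_block k Q (replicate (k * Q) x) n" for n
    proof -
      have idx: "j * Q + l < k * Q" if "j < k" "l < Q" for j l
      proof -
        have "j * Q + l < Suc j * Q" using that by simp
        also have "\<dots> \<le> k * Q" using that by (intro mult_right_mono) auto
        finally show ?thesis .
      qed
      have "norm_form_block k Q (replicate (k * Q) x) n = (\<Prod>j<k. \<Sum>i<n. \<Prod>l<Q. x n i)"
        unfolding norm_form_block_def by (intro prod.cong sum.cong refl) (simp add: idx)
      also have "\<dots> = (\<Sum>i<n. x n i ^ Q) ^ k" by simp
      \<comment> \<open>Evenness of \<open>Q\<close> removes the absolute values.\<close>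
      also have "(\<Sum>i<n. x n i ^ Q) = (\<Sum>i<n. \<bar>x n i\<bar> powr q)"
        using q Q by (simp add: powr_realpow' power_even_abs)
      also have "\<dots> ^ k = block_qnorm q x n powr p"
        using k p q by (simp add: block_qnorm_def powr_powr powr_realpow' sum_nonneg)
      finally show ?thesis by simp
    qed
    then show ?thesis by (simp add: lp_lq_norm_powr[OF p(2) x])
  qed
  \<comment> \<open>Only the homogeneous part of degree \<open>k * Q\<close> is present; the other
    degrees carry the zero form.\<close>
  define A where "A = (\<lambda>m xs. if m = k * Q then \<Sum>n. norm_form_block k Q xs n else 0)"
  have "multilinear_on (lp_lq_space p q) m (A m)" for m
  proof (cases "m = k * Q")
    case True
    then show ?thesis using norm_form_multilinear[OF q(1,3) p] by (simp add: A_def)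
  qed (simp add: A_def multilinear_on_def)
  moreover have "(\<Sum>m\<le>k * Q. A m (replicate m x)) = A (k * Q) (replicate (k * Q) x)" for x
  proof -
    have "(\<Sum>m\<le>k * Q. A m (replicate m x)) = (\<Sum>m\<in>{k * Q}. A m (replicate m x))"
      by (rule sum.mono_neutral_right) (auto simp: A_def)
    then show ?thesis by simp
  qed
  ultimately show "polynomial_on (lp_lq_space p q) (\<lambda>x. lp_lq_norm p q x powr p)"
    unfolding polynomial_on_def by (intro exI[of _ "k * Q"] exI[of _ A]) (simp add: diag A_def)
next
  fix x and e :: real assume x: "x \<in> lp_lq_space p q" and e: "e > 0"
  let ?n = "lp_lq_norm p q"
  have "continuous_on {0..} (\<lambda>t::real. t powr p)"
    using p by (intro continuous_on_powr') (auto intro: continuous_intros)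
  then have "\<exists>d>0. \<forall>t\<in>{0..}. dist t (?n x) < d \<longrightarrow> dist (t powr p) (?n x powr p) < e"
    unfolding continuous_on_iff using e lp_lq_norm_nonneg[of p q x] by (meson atLeast_iff)
  then obtain d where d: "d > 0" and
    dt: "\<And>t. 0 \<le> t \<Longrightarrow> \<bar>t - ?n x\<bar> < d \<Longrightarrow> \<bar>t powr p - ?n x powr p\<bar> < e"
    by (auto simp: dist_real_def)
  have "\<bar>?n y powr p - ?n x powr p\<bar> < e" if y: "y \<in> lp_lq_space p q" and yx: "?n (lincomb 1 y (-1) x) < d" for y
  proof (rule dt)
    define w where "w = lincomb 1 y (-1) x"
    have w: "w \<in> lp_lq_space p q"
      using x y lp_lq_subspace[OF p(2) q(3)] by (simp add: w_def linear_subspace_def)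
    \<comment> \<open>Two triangle inequalities show that the norm is 1-Lipschitz, so continuity of
      the real power carries over.\<close>
    have "y = lincomb 1 x 1 w" "x = lincomb 1 y (-1) w" by (auto simp: w_def lincomb_def)
    then have "?n y \<le> ?n x + ?n w" "?n x \<le> ?n y + ?n w"
      using lp_lq_norm_lincomb[OF p(2) q(3) x w, of 1 1] lp_lq_norm_lincomb[OF p(2) q(3) y w, of 1 "-1"]
      by auto
    then show "\<bar>?n y - ?n x\<bar> < d" using yx by (simp add: w_def)
  qed simp
  then show "\<exists>d>0. \<forall>y\<in>lp_lq_space p q. ?n (lincomb 1 y (-1) x) < d
      \<longrightarrow> \<bar>?n y powr p - ?n x powr p\<bar> < e"
    using d by blast
qed (use p q in \<open>auto simp: lp_lq_norm_zero\<close>)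

theorem theorem3p2:
  fixes p q :: real
  assumes "1 < p" and "1 < q"
  shows "(\<exists>P. separating_polynomial p q P) \<longleftrightarrow>
         ((\<exists>a::nat. p = 2 * real a) \<and> (\<exists>b::nat. q = 2 * real b) \<and> (\<exists>k::nat. p = real k * q))"
proof
  assume "\<exists>P. separating_polynomial p q P"
  then obtain P where P: "separating_polynomial p q P" by blast
  then obtain N where "polynomial_le (lp_lq_space p q) N P"
    unfolding separating_polynomial_def polynomial_on_def polynomial_le_def by blast
  with P assms interpret separating p q N P by unfold_locales
  obtain a :: nat where a: "p = 2 * real a" using p_even by blast
  then have "p = real (2 * a)" by simp
  then have "\<exists>k::nat. p = real k * q" by (rule p_multiple_of_q) simp
  then show "(\<exists>a::nat. p = 2 * real a) \<and> (\<exists>b::nat. q = 2 * real b) \<and> (\<exists>k::nat. p = real k * q)"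
    using p_even q_even by blast
next
  assume "(\<exists>a::nat. p = 2 * real a) \<and> (\<exists>b::nat. q = 2 * real b) \<and> (\<exists>k::nat. p = real k * q)"
  then obtain b k :: nat where "q = 2 * real b" "p = real k * q" by blast
  then have "separating_polynomial p q (\<lambda>x. lp_lq_norm p q x powr p)"
    using assms by (intro norm_power_separating[of q "2 * b" p k]) auto
  then show "\<exists>P. separating_polynomial p q P" by blast
qed

end
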